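(* Let $F_\theta$ be a member of the exponential-type parametric family with bounded support ($x_F<\infty$), satisfying the bounded endpoint regularity condition with constants $c_-,c_-'\ge0$. For any $\delta\in(0,1)$, let the exploration lengths $m=m(n)$ satisfy $m=o(n)$ and $m=\omega(\log(1/\delta)\log^2n)$ as $n\to\infty$. Then the stopping policy $\tau$ of the algorithm CDP-OL with horizon $n$, exploration length $m$ and confidence parameter $\delta$ satisfies $$\liminf_{n\to\infty}\mathrm{CR}_n(\tau;\theta)\ge1-\delta.$$
   Context: Exponential-type parametric family: $\theta>0$, $0\le x_0<x_F\le\infty$, and $\phi:[x_0,x_F)\to[0,\infty)$ is a known strictly increasing function with $\phi(x_0)=0$ and $\phi(x)\to\infty$ as $x\uparrow x_F$, with inverse $\psi:=\phi^{-1}:[0,\infty)\to[x_0,x_F)$ (so $\phi$ is a bijection). The CDF is $F_\theta(x)=0$ for $x<x_0$, $F_\theta(x)=1-\exp(-\theta\phi(x))$ for $x_0\le x<x_F$, and $F_\theta(x)=1$ for $x\ge x_F$. Bounded endpoint regularity condition: $x_F<\infty$, $\psi$ is eventually (for all large arguments) twice differentiable, and with $\bar\psi(y):=x_F-\psi(y)$ there exist $c_-,c_-'\in[0,\infty)$ with $\lim_{y\to\infty}\bar\psi'(y)/\bar\psi(y)=-c_-$ and $\lim_{y\to\infty}\bar\psi''(y)/\bar\psi'(y)=-c_-'$. Stopping problem: $X_1,\dots,X_n$ are i.i.d. from $F_\theta$ with $\theta$ unknown to the policy. A policy is a stopping time $\tau$ adapted to the sequentially observed $(X_t)$, with reward $X_\tau$.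 $\mathrm{OPT}(\theta):=\mathbb E_\theta[\max_{t\in[n]}X_t]$ and $\mathrm{CR}_n(\tau;\theta):=\mathbb E_\theta[X_\tau]/\mathrm{OPT}(\theta)$. Algorithm CDP-OL (inputs $n$, $1\le m<n$, $\delta$): reject $X_1,\dots,X_m$. Put $Y_i=\phi(X_i)$ for $i\le m$, $\widehat\theta_m=m/\sum_{i=1}^mY_i$, $\varepsilon_m=\sqrt{4\log(2/\delta)/m}$, $\theta^{(\mathrm U)}=(1+\varepsilon_m)\widehat\theta_m$, $N=n-m$. For $\eta>0$ let $r_\eta(a)=\int_a^{x_F}\exp(-\eta\phi(t))\,dt$. Compute $\widehat V_N=\mathbb E_{\theta^{(\mathrm U)}}[X_1]$ (the mean of $F_\eta$ at $\eta=\theta^{(\mathrm U)}$) and $\widehat V_i=\widehat V_{i+1}+r_{\theta^{(\mathrm U)}}(\widehat V_{i+1})$ for $i=N-1,\dots,1$. Then $\tau=m+t$ for the smallest $t\in\{1,\dots,N-1\}$ with $X_{m+t}\ge\widehat V_{t+1}$, and $\tau=n$ if no such $t$ exists. *)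

theory Defs
  imports "HOL-Probability.Probability" "HOL-Library.Landau_Symbols"
begin

text \<open>
  The family has bounded support, so the right endpoint is a real number. The function \<open>\<phi>\<close> is
  total in HOL, but only its values on \<open>{x0..<xF}\<close> are ever used.
\<close>

definition exp_type :: "real \<Rightarrow> real \<Rightarrow> (real \<Rightarrow> real) \<Rightarrow> bool" where
  "exp_type x0 xF \<phi> \<longleftrightarrow>
     0 \<le> x0 \<and> x0 < xF \<and>
     strict_mono_on {x0..<xF} \<phi> \<and> \<phi> x0 = 0 \<and> filterlim \<phi> at_top (at_left xF) \<and>
     bij_betw \<phi> {x0..<xF} {0..}"

definition exp_type_cdf :: "real \<Rightarrow> real \<Rightarrow> (real \<Rightarrow> real) \<Rightarrow> real \<Rightarrow> real \<Rightarrow> real" where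
  "exp_type_cdf x0 xF \<phi> \<theta> x =
     (if x < x0 then 0 else if x < xF then 1 - exp (- \<theta> * \<phi> x) else 1)"

definition exp_type_mean :: "real \<Rightarrow> real \<Rightarrow> (real \<Rightarrow> real) \<Rightarrow> real \<Rightarrow> real" where
  "exp_type_mean x0 xF \<phi> \<theta> = (LINT x|interval_measure (exp_type_cdf x0 xF \<phi> \<theta>). x)"

definition psi :: "real \<Rightarrow> real \<Rightarrow> (real \<Rightarrow> real) \<Rightarrow> real \<Rightarrow> real" where
  "psi x0 xF \<phi> = the_inv_into {x0..<xF} \<phi>"

definition psi_bar :: "real \<Rightarrow> real \<Rightarrow> (real \<Rightarrow> real) \<Rightarrow> real \<Rightarrow> real" where
  "psi_bar x0 xF \<phi> y = xF - psi x0 xF \<phi> y"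

definition bounded_endpoint_regular ::
    "real \<Rightarrow> real \<Rightarrow> (real \<Rightarrow> real) \<Rightarrow> real \<Rightarrow> real \<Rightarrow> bool" where
  "bounded_endpoint_regular x0 xF \<phi> c c' \<longleftrightarrow>
     (\<forall>\<^sub>F y in at_top. psi x0 xF \<phi> differentiable (at y)
                     \<and> deriv (psi x0 xF \<phi>) differentiable (at y)) \<and>
     0 \<le> c \<and> 0 \<le> c' \<and>
     ((\<lambda>y. deriv (psi_bar x0 xF \<phi>) y / psi_bar x0 xF \<phi> y) \<longlongrightarrow> - c) at_top \<and>
     ((\<lambda>y. deriv (deriv (psi_bar x0 xF \<phi>)) y / deriv (psi_bar x0 xF \<phi>) y) \<longlongrightarrow> - c') at_top"

definition iid_sample :: "'a measure \<Rightarrow> (nat \<Rightarrow> 'a \<Rightarrow> real) \<Rightarrow> nat \<Rightarrow> (real \<Rightarrow> real) \<Rightarrow> bool" where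
  "iid_sample M X n F \<longleftrightarrow>
     prob_space M \<and> prob_space.indep_vars M (\<lambda>_. borel) X {1..n} \<and>
     (\<forall>i\<in>{1..n}. cdf (distr M borel (X i)) = F)"

definition expected_max :: "'a measure \<Rightarrow> (nat \<Rightarrow> 'a \<Rightarrow> real) \<Rightarrow> nat \<Rightarrow> real" where
  "expected_max M X n = (LINT \<omega>|M. (MAX t\<in>{1..n}. X t \<omega>))"

definition competitive_ratio ::
    "'a measure \<Rightarrow> (nat \<Rightarrow> 'a \<Rightarrow> real) \<Rightarrow> nat \<Rightarrow> ('a \<Rightarrow> nat) \<Rightarrow> real" where
  "competitive_ratio M X n \<tau> = (LINT \<omega>|M. X (\<tau> \<omega>) \<omega>) / expected_max M X n"

text \<open>
  The algorithm is a function of the observed sequence \<open>x 1, x 2, \<dots>\<close>. An observation outside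
  \<open>{x0..<xF}\<close>, a null event, contributes \<open>0\<close> to the estimator. Evaluating \<open>\<phi>\<close> there instead
  could make the stopping rule non-measurable, as \<open>\<phi>\<close> is arbitrary off its domain.
\<close>

definition theta_hat :: "real \<Rightarrow> real \<Rightarrow> (real \<Rightarrow> real) \<Rightarrow> nat \<Rightarrow> (nat \<Rightarrow> real) \<Rightarrow> real" where
  "theta_hat x0 xF \<phi> m x =
     real m / (\<Sum>i=1..m. if x i \<in> {x0..<xF} then \<phi> (x i) else 0)"

definition theta_U ::
    "real \<Rightarrow> real \<Rightarrow> (real \<Rightarrow> real) \<Rightarrow> nat \<Rightarrow> real \<Rightarrow> (nat \<Rightarrow> real) \<Rightarrow> real" where
  "theta_U x0 xF \<phi> m \<delta> x = (1 + sqrt (4 * ln (2 / \<delta>) / real m)) * theta_hat x0 xF \<phi> m x"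

definition r_fun :: "real \<Rightarrow> (real \<Rightarrow> real) \<Rightarrow> real \<Rightarrow> real \<Rightarrow> real" where
  "r_fun xF \<phi> \<eta> a = (LBINT t:{a..<xF}. exp (- \<eta> * \<phi> t))"

definition V_hat :: "real \<Rightarrow> real \<Rightarrow> (real \<Rightarrow> real) \<Rightarrow> real \<Rightarrow> nat \<Rightarrow> nat \<Rightarrow> real" where
  "V_hat x0 xF \<phi> \<eta> N i = ((\<lambda>v. v + r_fun xF \<phi> \<eta> v) ^^ (N - i)) (exp_type_mean x0 xF \<phi> \<eta>)"

lemma V_hat_last: "V_hat x0 xF \<phi> \<eta> N N = exp_type_mean x0 xF \<phi> \<eta>"
  by (simp add: V_hat_def)

lemma V_hat_step:
  assumes "i < N"
  shows "V_hat x0 xF \<phi> \<eta> N i =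
           V_hat x0 xF \<phi> \<eta> N (i + 1) + r_fun xF \<phi> \<eta> (V_hat x0 xF \<phi> \<eta> N (i + 1))"
proof -
  have "N - i = Suc (N - (i + 1))"
    using assms by simp
  then show ?thesis
    by (simp add: V_hat_def)
qed

definition cdp_ol ::
    "real \<Rightarrow> real \<Rightarrow> (real \<Rightarrow> real) \<Rightarrow> nat \<Rightarrow> nat \<Rightarrow> real \<Rightarrow> (nat \<Rightarrow> real) \<Rightarrow> nat" where
  "cdp_ol x0 xF \<phi> n m \<delta> x =
     (let N = n - m;
          \<eta> = theta_U x0 xF \<phi> m \<delta> x;
          S = {t \<in> {1..N - 1}. x (m + t) \<ge> V_hat x0 xF \<phi> \<eta> N (t + 1)}
      in if S = {} then n else m + Min S)"

text \<open>
  The rule is non-anticipating: whether it stops at time \<open>t\<close> depends only on \<open>x 1, \<dots>, x t\<close>.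
\<close>

lemma cdp_ol_nonanticipating:
  assumes "m < n" and agree: "\<And>i. i \<in> {1..t} \<Longrightarrow> x i = y i"
    and stop: "cdp_ol x0 xF \<phi> n m \<delta> x = t"
  shows "cdp_ol x0 xF \<phi> n m \<delta> y = t"
proof -
  define N where "N = n - m"
  define S where
    "S x = {s \<in> {1..N - 1}. x (m + s) \<ge> V_hat x0 xF \<phi> (theta_U x0 xF \<phi> m \<delta> x) N (s + 1)}"
    for x :: "nat \<Rightarrow> real"
  have rule: "cdp_ol x0 xF \<phi> n m \<delta> z = (if S z = {} then n else m + Min (S z))" for z
    unfolding cdp_ol_def S_def N_def Let_def by (rule refl)
  have fin: "finite (S z)" for z
    by (simp add: S_def)
  have "m \<le> t"
    using stop rule[of x] \<open>m < n\<close> by (auto split: if_splits)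
  then have "theta_hat x0 xF \<phi> m x = theta_hat x0 xF \<phi> m y"
    unfolding theta_hat_def using agree
    by (intro arg_cong2[where f = "(/)"] sum.cong) auto
  then have th: "theta_U x0 xF \<phi> m \<delta> x = theta_U x0 xF \<phi> m \<delta> y"
    by (simp add: theta_U_def)
  have same: "s \<in> S x \<longleftrightarrow> s \<in> S y" if "m + s \<le> t" for s
    using that agree[of "m + s"] th by (auto simp: S_def)
  show ?thesis
  proof (cases "S x = {}")
    case True
    then have "t = n"
      using stop rule[of x] by simp
    have "m + s \<le> t" if "s \<in> S y" for s
      using that \<open>t = n\<close> by (auto simp: S_def N_def)
    then have "S y = {}"
      using same True by blast
    then show ?thesis
      using rule[of y] \<open>t = n\<close> by simp
  next
    case False
    then have t: "t = m + Min (S x)"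
      using stop rule[of x] by simp
    have "Min (S x) \<in> S y"
      using Min_in[OF fin False] same t by simp
    moreover have "Min (S x) \<le> s" if "s \<in> S y" for s
    proof (rule ccontr)
      assume "\<not> Min (S x) \<le> s"
      then have "s \<in> S x"
        using same[of s] that t by simp
      then show False
        using Min_le[OF fin, of s x] \<open>\<not> Min (S x) \<le> s\<close> by simp
    qed
    ultimately have "Min (S y) = Min (S x)"
      using fin by (intro Min_eqI) auto
    then show ?thesis
      using rule[of y] t \<open>Min (S x) \<in> S y\<close> by auto
  qed
qed

end

theory Submission
  imports Defs
begin

text \<open>
  The support is bounded, so it suffices that with probability close to one the accepted value is
  close to \<open>xF\<close>. The mean of \<open>F\<^sub>\<eta>\<close> is \<open>x0 + r\<^sub>\<eta>(x0)\<close>, so all thresholds are iterates of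
  \<open>v \<mapsto> v + r\<^sub>\<eta>(v)\<close> from \<open>x0\<close>; they decrease in \<open>\<eta>\<close> and increase to \<open>xF\<close>. Hence a stop with at least
  \<open>K\<close> remaining steps accepts a value near \<open>xF\<close> as soon as the estimated rate is at most \<open>2\<theta>\<close>.

  Chebyshev's inequality and \<open>m = \<omega>(log\<^sup>2 n)\<close> bound the estimated rate below by the deterministic
  number \<open>\<eta> = \<theta>(1 - 1/ln n)\<close>, outside an event of vanishing probability. By monotonicity of the
  thresholds, not stopping then implies not exceeding the thresholds for \<open>\<eta>\<close>, an event about
  independent variables. Endpoint regularity gives \<open>exp (\<eta> \<phi>(v\<^sub>k)) \<le> A + D k\<close> for the \<open>k\<close>-th iterate
  \<open>v\<^sub>k\<close>. Since \<open>k powr (\<theta>/\<eta> - 1)\<close> is bounded for \<open>k \<le> n\<close>, the acceptance probabilities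
  \<open>exp (- \<theta> \<phi>(v\<^sub>k))\<close> are at least of order \<open>1/k\<close>, and their sum diverges.
\<close>

section \<open>Means of bounded distributions as tail integrals\<close>

lemma (in real_distribution) expectation_eq_integral_cdf:
  assumes "a \<le> b" and ae: "AE x in M. a \<le> x \<and> x \<le> b"
  shows "expectation (\<lambda>x. x) = a + (LBINT t:{a..<b}. 1 - cdf M t)"
proof -
  interpret P: pair_sigma_finite M lborel ..
  have cdf_le: "cdf M t \<le> 1" for t
    by (simp add: cdf_def)
  have mcdf[measurable]: "cdf M \<in> borel_measurable borel"
    by (rule borel_measurable_mono) (simp add: mono_def cdf_nondecreasing)
  have int: "integrable M (\<lambda>x. x)"
    using ae by (intro integrable_const_bound[where B = "max \<bar>a\<bar> \<bar>b\<bar>"]) auto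
  have set_int: "set_integrable lborel {a..<b} (\<lambda>t. 1 - cdf M t)"
  proof (rule set_integrable_bound)
    show "set_integrable lborel {a..<b} (\<lambda>_. 1 :: real)"
      using assms(1) by (simp add: set_integrable_def)
    show "set_borel_measurable lborel {a..<b} (\<lambda>t. 1 - cdf M t)"
      unfolding set_borel_measurable_def by measurable
    show "AE t in lborel. t \<in> {a..<b} \<longrightarrow> norm (1 - cdf M t) \<le> norm (1 :: real)"
      using cdf_le cdf_nonneg by (auto intro!: always_eventually)
  qed
  have tail: "emeasure M {t<..} = ennreal (1 - cdf M t)" for t
  proof -
    have "measure M {t<..} = measure M (space M - {..t})"
      by (intro arg_cong[where f = "measure M"]) auto
    also have "\<dots> = 1 - cdf M t"
      by (subst prob_compl) (auto simp: cdf_def)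
    finally show ?thesis
      by (simp add: emeasure_eq_measure)
  qed
  have "ennreal (expectation (\<lambda>x. x - a)) = (\<integral>\<^sup>+x. ennreal (x - a) \<partial>M)"
    using int ae by (intro nn_integral_eq_integral[symmetric]) auto
  \<comment> \<open>Layer-cake formula: \<open>x - a\<close> is the length of
    \<open>{a..<x}\<close>, and Tonelli then turns the inner integral over \<open>x\<close> into a
    tail probability. The bound \<open>t < b\<close> in the indicator holds by itself for
    \<open>t < x\<close>, since \<open>x \<le> b\<close> almost everywhere.\<close>
  also have "\<dots> = (\<integral>\<^sup>+x. (\<integral>\<^sup>+t. indicator {(x,t). a \<le> t \<and> t < b \<and> t < x} (x, t) \<partial>lborel) \<partial>M)"
  proof (rule nn_integral_cong_AE)
    show "AE x in M. ennreal (x - a) = (\<integral>\<^sup>+t. indicator {(x,t). a \<le> t \<and> t < b \<and> t < x} (x, t) \<partial>lborel)"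
      using ae
    proof eventually_elim
      case (elim x)
      have "(\<integral>\<^sup>+t. indicator {(x,t). a \<le> t \<and> t < b \<and> t < x} (x, t) \<partial>lborel)
          = (\<integral>\<^sup>+t. indicator {a..<x} t \<partial>lborel)"
        using elim by (intro nn_integral_cong) (auto simp: indicator_def)
      then show ?case
        using elim by simp
    qed
  qed
  also have "\<dots> = (\<integral>\<^sup>+t. (\<integral>\<^sup>+x. indicator {(x,t). a \<le> t \<and> t < b \<and> t < x} (x, t) \<partial>M) \<partial>lborel)"
    by (rule P.Fubini'[symmetric]) measurable
  also have "\<dots> = (\<integral>\<^sup>+t. ennreal (indicator {a..<b} t *\<^sub>R (1 - cdf M t)) \<partial>lborel)"
  proof (rule nn_integral_cong)
    fix t
    have "(\<integral>\<^sup>+x. indicator {(x,t). a \<le> t \<and> t < b \<and> t < x} (x, t) \<partial>M)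
        = (\<integral>\<^sup>+x. indicator {a..<b} t * indicator {t<..} x \<partial>M)"
      by (intro nn_integral_cong) (auto simp: indicator_def)
    also have "\<dots> = indicator {a..<b} t * emeasure M {t<..}"
      by (simp add: nn_integral_cmult)
    finally show "(\<integral>\<^sup>+x. indicator {(x,t). a \<le> t \<and> t < b \<and> t < x} (x, t) \<partial>M)
        = ennreal (indicator {a..<b} t *\<^sub>R (1 - cdf M t))"
      by (simp add: tail indicator_def)
  qed
  also have "\<dots> = ennreal (LBINT t:{a..<b}. 1 - cdf M t)"
    unfolding set_lebesgue_integral_def
    using set_int cdf_le by (intro nn_integral_eq_integral) (auto simp: set_integrable_def)
  finally have "expectation (\<lambda>x. x - a) = (LBINT t:{a..<b}. 1 - cdf M t)"
  proof (subst (asm) ennreal_inj)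
    show "0 \<le> expectation (\<lambda>x. x - a)"
      using ae by (intro integral_nonneg_AE) auto
    show "0 \<le> (LBINT t:{a..<b}. 1 - cdf M t)"
      unfolding set_lebesgue_integral_def
      using cdf_le by (intro integral_nonneg_AE) (auto intro!: always_eventually)
  qed
  then show ?thesis
    using int prob_space by (simp del: space_eq_univ)
qed

subsection \<open>The family and its threshold recursion\<close>

locale exp_type_family =
  fixes x0 xF :: real and \<phi> :: "real \<Rightarrow> real"
  assumes exp_type: "exp_type x0 xF \<phi>"
begin

lemma x0_nonneg: "0 \<le> x0"
  and x0_less_xF: "x0 < xF"
  and strict_mono_phi: "strict_mono_on {x0..<xF} \<phi>"
  and phi_x0 [simp]: "\<phi> x0 = 0"
  and bij_phi: "bij_betw \<phi> {x0..<xF} {0..}"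
  using exp_type by (auto simp: exp_type_def)

lemma phi_less: "x0 \<le> a \<Longrightarrow> a < b \<Longrightarrow> b < xF \<Longrightarrow> \<phi> a < \<phi> b"
  using strict_mono_phi by (simp add: strict_mono_on_def)

lemma phi_le: "x0 \<le> a \<Longrightarrow> a \<le> b \<Longrightarrow> b < xF \<Longrightarrow> \<phi> a \<le> \<phi> b"
  using phi_less[of a b] by (cases "a = b") auto

lemma phi_nonneg: "x0 \<le> a \<Longrightarrow> a < xF \<Longrightarrow> 0 \<le> \<phi> a"
  using phi_le[of x0 a] by simp

abbreviation "\<psi> \<equiv> psi x0 xF \<phi>"

lemma psi_bounds: "0 \<le> y \<Longrightarrow> x0 \<le> \<psi> y" "0 \<le> y \<Longrightarrow> \<psi> y < xF"
  and phi_psi: "0 \<le> y \<Longrightarrow> \<phi> (\<psi> y) = y"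
proof -
  assume "0 \<le> y"
  then have "y \<in> \<phi> ` {x0..<xF}"
    using bij_phi by (simp add: bij_betw_def)
  moreover have "inj_on \<phi> {x0..<xF}"
    using bij_phi by (simp add: bij_betw_def)
  ultimately show "x0 \<le> \<psi> y" "\<psi> y < xF" "\<phi> (\<psi> y) = y"
    using the_inv_into_into[of \<phi> "{x0..<xF}" y "{x0..<xF}"] f_the_inv_into_f[of \<phi> "{x0..<xF}" y]
    by (auto simp: psi_def)
qed

lemma psi_phi: "x0 \<le> a \<Longrightarrow> a < xF \<Longrightarrow> \<psi> (\<phi> a) = a"
  unfolding psi_def using bij_phi by (intro the_inv_into_f_f) (auto simp: bij_betw_def)

lemma psi_less:
  assumes "0 \<le> y" "y < z"
  shows "\<psi> y < \<psi> z"
proof (rule ccontr)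
  assume "\<not> \<psi> y < \<psi> z"
  then have "\<phi> (\<psi> z) \<le> \<phi> (\<psi> y)"
    using assms psi_bounds[of y] psi_bounds[of z] by (intro phi_le) auto
  then show False
    using assms by (simp add: phi_psi)
qed

lemma psi_le: "0 \<le> y \<Longrightarrow> y \<le> z \<Longrightarrow> \<psi> y \<le> \<psi> z"
  using psi_less[of y z] by (cases "y = z") auto

lemma phi_le_iff:
  assumes "x0 \<le> a" "a < xF" "0 \<le> y"
  shows "\<phi> a \<le> y \<longleftrightarrow> a \<le> \<psi> y"
proof
  assume "\<phi> a \<le> y"
  then show "a \<le> \<psi> y"
    using psi_le[of "\<phi> a" y] assms phi_nonneg[of a] by (simp add: psi_phi)
next
  assume "a \<le> \<psi> y"
  then show "\<phi> a \<le> y"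
    using phi_le[of a "\<psi> y"] assms psi_bounds[of y] by (simp add: phi_psi)
qed

text \<open>The linear continuation to the left of \<open>x0\<close> makes \<open>\<phi>\<close> a
  monotone surjection of the open half-line \<open>{..<xF}\<close> onto the reals. A monotone
  function with open image is continuous, so continuity at the endpoint \<open>x0\<close> comes out
  as well.\<close>

definition phi_ext :: "real \<Rightarrow> real" where
  "phi_ext x = (if x < x0 then x - x0 else \<phi> x)"

lemma continuous_on_phi_ext: "continuous_on {..<xF} phi_ext"
proof (rule continuous_onI_mono)
  have "y \<in> phi_ext ` {..<xF}" for y
  proof (cases "y < 0")
    case True
    then show ?thesis
      using x0_less_xF by (intro image_eqI[where x = "y + x0"]) (auto simp: phi_ext_def)
  next
    case False
    then show ?thesis
      using phi_psi[of y] psi_bounds[of y]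
      by (intro image_eqI[where x = "\<psi> y"]) (auto simp: phi_ext_def)
  qed
  then have "phi_ext ` {..<xF} = UNIV"
    by auto
  then show "open (phi_ext ` {..<xF})"
    by simp
  show "phi_ext x \<le> phi_ext y" if "x \<in> {..<xF}" "y \<in> {..<xF}" "x \<le> y" for x y
    using that phi_le[of x y] phi_nonneg[of y] by (auto simp: phi_ext_def)
qed

lemma continuous_on_phi: "continuous_on {x0..<xF} \<phi>"
proof -
  have "continuous_on {x0..<xF} phi_ext"
    by (rule continuous_on_subset[OF continuous_on_phi_ext]) auto
  then show ?thesis
    by (rule continuous_on_eq) (auto simp: phi_ext_def)
qed

section \<open>The tail integral\<close>

abbreviation "r \<equiv> r_fun xF \<phi>"

lemma set_integrable_exp_phi:
  assumes "0 \<le> \<eta>" "A \<in> sets borel" "A \<subseteq> {x0..<xF}"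
  shows "set_integrable lborel A (\<lambda>t. exp (- \<eta> * \<phi> t))"
proof (rule set_integrable_subset)
  show "set_integrable lborel {x0..<xF} (\<lambda>t. exp (- \<eta> * \<phi> t))"
  proof (rule set_integrable_bound)
    show "set_integrable lborel {x0..<xF} (\<lambda>_. 1 :: real)"
      using x0_less_xF by (simp add: set_integrable_def)
    have "continuous_on {x0..<xF} (\<lambda>t. exp (- \<eta> * \<phi> t))"
      by (intro continuous_intros continuous_on_phi)
    then show "set_borel_measurable lborel {x0..<xF} (\<lambda>t. exp (- \<eta> * \<phi> t))"
      unfolding set_borel_measurable_def
      by (simp add: borel_measurable_continuous_on_indicator del: mult_minus_left real_scaleR_def)
    show "AE t in lborel. t \<in> {x0..<xF} \<longrightarrow> norm (exp (- \<eta> * \<phi> t)) \<le> norm (1 :: real)"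
      using assms(1) phi_nonneg by (auto intro!: always_eventually)
  qed
qed (use assms in auto)

lemma r_antimono_param:
  assumes "0 \<le> \<eta>" "\<eta> \<le> \<eta>'" "x0 \<le> a"
  shows "r \<eta>' a \<le> r \<eta> a"
  unfolding r_fun_def using assms phi_nonneg
  by (intro set_integral_mono set_integrable_exp_phi) (auto intro!: mult_right_mono)

lemma r_diff:
  assumes "0 \<le> \<eta>" "x0 \<le> a" "a \<le> b" "b < xF"
  shows "r \<eta> a - r \<eta> b = (LBINT t:{a..<b}. exp (- \<eta> * \<phi> t))"
proof -
  have "{a..<xF} = {a..<b} \<union> {b..<xF}"
    using assms by auto
  moreover have "(LBINT t:{a..<b} \<union> {b..<xF}. exp (- \<eta> * \<phi> t))
      = (LBINT t:{a..<b}. exp (- \<eta> * \<phi> t)) + (LBINT t:{b..<xF}. exp (- \<eta> * \<phi> t))"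
    using assms by (intro set_integral_Un set_integrable_exp_phi) auto
  ultimately show ?thesis
    by (simp add: r_fun_def)
qed

text \<open>The integrand is decreasing, so the integral over \<open>{a..<b}\<close> lies between
  its endpoint values times \<open>b - a\<close>. Positivity, strict bounds, monotonicity and the
  derivative of \<open>r \<eta>\<close> all rest on these two inequalities.\<close>

lemma r_sandwich:
  assumes "0 \<le> \<eta>" "x0 \<le> a" "a \<le> b" "b < xF"
  shows "exp (- \<eta> * \<phi> b) * (b - a) \<le> r \<eta> a - r \<eta> b"
    and "r \<eta> a - r \<eta> b \<le> exp (- \<eta> * \<phi> a) * (b - a)"
proof -
  have const: "set_integrable lborel {a..<b} (\<lambda>_. C :: real)"
    and lint: "(LBINT t:{a..<b}. C) = C * (b - a)" for C
    using assms by (simp_all add: set_integrable_def set_lebesgue_integral_def)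
  have "(LBINT t:{a..<b}. exp (- \<eta> * \<phi> b)) \<le> (LBINT t:{a..<b}. exp (- \<eta> * \<phi> t))"
    using assms by (intro set_integral_mono const set_integrable_exp_phi)
      (auto intro!: mult_left_mono phi_le)
  moreover have "(LBINT t:{a..<b}. exp (- \<eta> * \<phi> t)) \<le> (LBINT t:{a..<b}. exp (- \<eta> * \<phi> a))"
    using assms by (intro set_integral_mono const set_integrable_exp_phi)
      (auto intro!: mult_left_mono phi_le)
  ultimately show "exp (- \<eta> * \<phi> b) * (b - a) \<le> r \<eta> a - r \<eta> b"
    "r \<eta> a - r \<eta> b \<le> exp (- \<eta> * \<phi> a) * (b - a)"
    using r_diff[OF assms] by (simp_all add: lint)
qed

lemma r_nonneg: "0 \<le> r \<eta> a"
  unfolding r_fun_def set_lebesgue_integral_def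
  by (intro integral_nonneg_AE) (auto intro!: always_eventually)

lemma r_le:
  assumes "0 \<le> \<eta>" "x0 \<le> a" "a < xF"
  shows "r \<eta> a \<le> xF - a"
proof -
  have "r \<eta> a \<le> (LBINT t:{a..<xF}. 1)"
    unfolding r_fun_def using assms phi_nonneg
    by (intro set_integral_mono set_integrable_exp_phi) (auto simp: set_integrable_def)
  also have "\<dots> = xF - a"
    using assms by (simp add: set_lebesgue_integral_def)
  finally show ?thesis .
qed

lemma r_less:
  assumes "0 < \<eta>" "x0 \<le> a" "a < xF"
  shows "r \<eta> a < xF - a"
proof -
  \<comment> \<open>The integrand is 1 at \<open>x0\<close>, so for \<open>a = x0\<close> strictness
    cannot be read off at \<open>a\<close>. It is gained on \<open>{b..<d}\<close>, where the
    integrand is at most \<open>exp (- \<eta> * \<phi> b) < 1\<close>; the pieces on either side use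
    the bound 1.\<close>
  define b where "b = (a + xF) / 2"
  define d where "d = (b + xF) / 2"
  have b: "a < b" "b < d" "d < xF"
    using assms by (auto simp: b_def d_def field_simps)
  have "0 < \<phi> b"
    using phi_less[of x0 b] b assms by simp
  then have "exp (- \<eta> * \<phi> b) < 1"
    using assms by simp
  then have "exp (- \<eta> * \<phi> b) * (d - b) < 1 * (d - b)"
    using b by (intro mult_strict_right_mono) auto
  then have "r \<eta> b - r \<eta> d < d - b"
    using r_sandwich(2)[of \<eta> b d] assms b by (smt (verit))
  moreover have "r \<eta> d \<le> xF - d"
    using r_le[of \<eta> d] b assms by simp
  moreover have "r \<eta> a - r \<eta> b \<le> b - a"
  proof -
    have "exp (- \<eta> * \<phi> a) * (b - a) \<le> 1 * (b - a)"
      using assms b phi_nonneg[of a] by (intro mult_right_mono) auto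
    then show ?thesis
      using r_sandwich(2)[of \<eta> a b] assms b by (smt (verit))
  qed
  ultimately show ?thesis
    by simp
qed

lemma r_pos:
  assumes "0 \<le> \<eta>" "x0 \<le> a" "a < xF"
  shows "0 < r \<eta> a"
proof -
  define b where "b = (a + xF) / 2"
  have b: "a < b" "b < xF"
    using assms by (auto simp: b_def field_simps)
  have "0 < exp (- \<eta> * \<phi> b) * (b - a)"
    using b by simp
  then show ?thesis
    using r_sandwich(1)[of \<eta> a b] r_nonneg[of \<eta> b] assms b by linarith
qed

lemma r_antimono:
  assumes "0 \<le> \<eta>" "x0 \<le> a" "a \<le> b" "b < xF"
  shows "r \<eta> b \<le> r \<eta> a"
  using r_sandwich(1)[OF assms] assms
  by (smt (verit) exp_ge_zero mult_nonneg_nonneg)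

section \<open>Iterates of the dynamic programming step\<close>

definition dp_step :: "real \<Rightarrow> real \<Rightarrow> real" where
  "dp_step \<eta> v = v + r \<eta> v"

lemma dp_step_bounds:
  assumes "0 < \<eta>" "x0 \<le> v" "v < xF"
  shows "v \<le> dp_step \<eta> v" "dp_step \<eta> v < xF"
  using assms r_less[of \<eta> v] r_nonneg[of \<eta> v] by (auto simp: dp_step_def)

text \<open>The integrand is at most 1, so \<open>r \<eta>\<close> falls by at most
  \<open>b - a\<close> between \<open>a\<close> and \<open>b\<close>.\<close>

lemma dp_step_mono:
  assumes "0 \<le> \<eta>" "x0 \<le> a" "a \<le> b" "b < xF"
  shows "dp_step \<eta> a \<le> dp_step \<eta> b"
proof -
  have "exp (- \<eta> * \<phi> a) * (b - a) \<le> 1 * (b - a)"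
    using assms phi_nonneg[of a] by (intro mult_right_mono) auto
  then show ?thesis
    using r_sandwich(2)[OF assms] by (simp add: dp_step_def)
qed

text \<open>For \<open>\<eta> > 0\<close> this is the optimal expected reward from \<open>k\<close>
  independent draws with known rate \<open>\<eta>\<close>: the mean of \<open>max X v\<close> is
  \<open>v + r \<eta> v\<close> for \<open>v\<close> in the support. The start \<open>x0\<close>
  stands for zero draws, which makes the mean the first iterate.\<close>

definition dp_value :: "real \<Rightarrow> nat \<Rightarrow> real" where
  "dp_value \<eta> k = (dp_step \<eta> ^^ k) x0"

lemma dp_value_0 [simp]: "dp_value \<eta> 0 = x0"
  and dp_value_Suc: "dp_value \<eta> (Suc k) = dp_step \<eta> (dp_value \<eta> k)"
  by (simp_all add: dp_value_def)

lemma dp_value_bounds: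
  assumes "0 < \<eta>"
  shows "x0 \<le> dp_value \<eta> k" "dp_value \<eta> k < xF"
proof -
  have "x0 \<le> dp_value \<eta> k \<and> dp_value \<eta> k < xF"
    by (induction k) (use assms x0_less_xF dp_step_bounds in \<open>force simp: dp_value_Suc\<close>)+
  then show "x0 \<le> dp_value \<eta> k" "dp_value \<eta> k < xF"
    by auto
qed

lemma dp_value_incseq: "0 < \<eta> \<Longrightarrow> incseq (dp_value \<eta>)"
  using dp_step_bounds(1) dp_value_bounds by (intro incseq_SucI) (simp add: dp_value_Suc)

lemma dp_value_antimono_param:
  assumes "0 < \<eta>" "\<eta> \<le> \<eta>'"
  shows "dp_value \<eta>' k \<le> dp_value \<eta> k"
proof (induction k)
  case (Suc k)
  have "dp_step \<eta>' (dp_value \<eta>' k) \<le> dp_step \<eta>' (dp_value \<eta> k)"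
    using assms Suc dp_value_bounds[of \<eta>' k] dp_value_bounds[of \<eta> k] by (intro dp_step_mono) auto
  also have "\<dots> \<le> dp_step \<eta> (dp_value \<eta> k)"
    using assms dp_value_bounds[of \<eta> k] by (simp add: dp_step_def r_antimono_param)
  finally show ?case
    by (simp add: dp_value_Suc)
qed simp

text \<open>As long as the iterates stay below \<open>b\<close>, each step gains at least the fixed
  amount \<open>r \<eta> b > 0\<close>, which the bounded support cannot accommodate
  forever.\<close>

lemma dp_value_eventually_ge:
  assumes "0 < \<eta>" "b < xF"
  obtains k where "b \<le> dp_value \<eta> k"
proof (rule ccontr)
  assume "\<not> thesis"
  then have less: "dp_value \<eta> k < b" for k
    using that by (meson linorder_not_le)
  have b: "x0 < b"
    using less[of 0] by simp
  have "x0 + real k * r \<eta> b \<le> dp_value \<eta> k" for k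
  proof (induction k)
    case (Suc k)
    have "r \<eta> b \<le> r \<eta> (dp_value \<eta> k)"
      using assms dp_value_bounds[of \<eta> k] less[of k] by (intro r_antimono) auto
    then show ?case
      using Suc by (simp add: dp_value_Suc dp_step_def algebra_simps)
  qed simp
  moreover obtain k where "xF - x0 < real k * r \<eta> b"
    using reals_Archimedean3[OF r_pos[of \<eta> b]] assms b by auto
  ultimately show False
    using dp_value_bounds(2)[OF assms(1), of k] by (smt (verit))
qed

section \<open>The distribution function, its mean and the thresholds of the algorithm\<close>

abbreviation "F \<equiv> exp_type_cdf x0 xF \<phi>"

lemma cdf_at_right:
  assumes "0 < \<eta>"
  shows "continuous (at_right a) (F \<eta>)"
proof (cases "a < xF")
  case True
  have "isCont phi_ext a"
    using continuous_on_phi_ext True by (simp add: continuous_on_eq_continuous_at)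
  \<comment> \<open>\<open>max 0\<close> absorbs the branch below \<open>x0\<close>, where
    \<open>phi_ext\<close> is negative, so one continuous formula covers everything left of
    \<open>xF\<close>.\<close>
  then have "isCont (\<lambda>x. 1 - exp (- \<eta> * max 0 (phi_ext x))) a"
    by (intro continuous_intros)
  moreover have "\<forall>\<^sub>F x in nhds a. F \<eta> x = 1 - exp (- \<eta> * max 0 (phi_ext x))"
    by (rule eventually_mono[OF eventually_nhds_in_open[of "{..<xF}"]])
      (use True phi_nonneg in \<open>auto simp: exp_type_cdf_def phi_ext_def\<close>)
  ultimately have "isCont (F \<eta>) a"
    using isCont_cong[of "F \<eta>" "\<lambda>x. 1 - exp (- \<eta> * max 0 (phi_ext x))" a] by simp
  then show ?thesis
    by (rule continuous_at_imp_continuous_at_within)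
next
  case False
  have "(F \<eta> \<longlongrightarrow> 1) (at_right a)"
    by (rule tendsto_eventually)
      (use False x0_less_xF in \<open>auto simp: eventually_at_filter exp_type_cdf_def intro!: always_eventually\<close>)
  then show ?thesis
    using False x0_less_xF by (simp add: continuous_within exp_type_cdf_def)
qed

lemma cdf_mono:
  assumes "0 < \<eta>" "x \<le> y"
  shows "F \<eta> x \<le> F \<eta> y"
proof -
  consider "x < x0" | "xF \<le> y" | "x0 \<le> x" "y < xF"
    by linarith
  then show ?thesis
  proof cases
    case 1
    then show ?thesis
      using assms phi_nonneg[of y] by (auto simp: exp_type_cdf_def)
  next
    case 2
    then show ?thesis
      using assms x0_less_xF by (auto simp: exp_type_cdf_def)
  next
    case 3
    then show ?thesis
      using assms phi_le[of x y] by (auto simp: exp_type_cdf_def)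
  qed
qed

lemma cdf_at_bot: "(F \<eta> \<longlongrightarrow> 0) at_bot"
  by (rule tendsto_eventually)
    (auto simp: exp_type_cdf_def eventually_at_bot_linorder intro!: exI[of _ "x0 - 1"])

lemma cdf_at_top: "(F \<eta> \<longlongrightarrow> 1) at_top"
  by (rule tendsto_eventually)
    (use x0_less_xF in \<open>auto simp: exp_type_cdf_def eventually_at_top_linorder intro!: exI[of _ xF]\<close>)

lemma exp_type_mean_eq:
  assumes "0 < \<eta>"
  shows "exp_type_mean x0 xF \<phi> \<eta> = dp_step \<eta> x0"
proof -
  interpret D: real_distribution "interval_measure (F \<eta>)"
    using assms cdf_mono cdf_at_right cdf_at_bot cdf_at_top
    by (intro real_distribution_interval_measure) auto
  have cdf: "cdf (interval_measure (F \<eta>)) = F \<eta>"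
    using assms cdf_mono cdf_at_right cdf_at_bot by (intro cdf_interval_measure) auto
  have "D.prob {..x0} = 0" "D.prob {..xF} = 1"
    using fun_cong[OF cdf, of x0] fun_cong[OF cdf, of xF] x0_less_xF
    by (simp_all add: cdf_def exp_type_cdf_def)
  then have null: "{..x0} \<in> null_sets (interval_measure (F \<eta>))"
    and le: "AE x in interval_measure (F \<eta>). x \<in> {..xF}"
    using D.AE_prob_1[of "{..xF}"] by (auto simp: null_sets_def D.emeasure_eq_measure)
  from AE_not_in[OF null] le have "AE x in interval_measure (F \<eta>). x0 \<le> x \<and> x \<le> xF"
    by eventually_elim auto
  then have "exp_type_mean x0 xF \<phi> \<eta> = x0 + (LBINT t:{x0..<xF}. 1 - F \<eta> t)"
    using D.expectation_eq_integral_cdf[of x0 xF] x0_less_xF by (simp add: exp_type_mean_def cdf)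
  also have "(LBINT t:{x0..<xF}. 1 - F \<eta> t) = r \<eta> x0"
    unfolding r_fun_def by (intro set_lebesgue_integral_cong) (auto simp: exp_type_cdf_def)
  finally show ?thesis
    by (simp add: dp_step_def)
qed

text \<open>The algorithm starts its recursion from the mean, which is already one step above
  \<open>x0\<close>; hence \<open>Suc N - i\<close> iterates rather than
  \<open>N - i\<close>.\<close>

lemma V_hat_eq_dp_value:
  assumes "0 < \<eta>" "i \<le> N"
  shows "V_hat x0 xF \<phi> \<eta> N i = dp_value \<eta> (Suc N - i)"
proof -
  have "Suc N - i = Suc (N - i)"
    using assms by simp
  moreover have "(\<lambda>v. v + r \<eta> v) = dp_step \<eta>"
    by (simp add: dp_step_def fun_eq_iff)
  ultimately show ?thesis
    using assms by (simp add: V_hat_def dp_value_def exp_type_mean_eq funpow_swap1)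
qed

lemma borel_measurable_V_hat:
  assumes f: "f \<in> borel_measurable M" and nonneg: "\<And>\<omega>. 0 \<le> f \<omega>" and "i \<le> N"
  shows "(\<lambda>\<omega>. V_hat x0 xF \<phi> (f \<omega>) N i) \<in> borel_measurable M"
proof -
  have "mono_on {0<..} (\<lambda>\<eta>. - dp_value \<eta> (Suc N - i))"
    by (intro mono_onI) (simp add: dp_value_antimono_param)
  then have U: "(\<lambda>\<eta>. - dp_value \<eta> (Suc N - i)) \<in> borel_measurable (restrict_space borel {0<..})"
    by (rule borel_measurable_mono_on_fnc)
  \<comment> \<open>On positive rates the threshold is decreasing, so its negative is monotone and
    Borel. The only other value of \<open>f\<close> is 0, which the estimate takes by division by
    zero; there the threshold is a constant.\<close>
  define g where "g \<eta> = (if \<eta> \<in> {0<..} then - dp_value \<eta> (Suc N - i) else - V_hat x0 xF \<phi> 0 N i)"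
    for \<eta>
  have "g \<in> borel_measurable borel"
    unfolding g_def using U by (subst measurable_If_restrict_space_iff) (auto simp: greaterThan_def)
  then have "(\<lambda>\<omega>. - g (f \<omega>)) \<in> borel_measurable M"
    using f by (intro borel_measurable_uminus) (rule measurable_compose)
  moreover have "- g (f \<omega>) = V_hat x0 xF \<phi> (f \<omega>) N i" for \<omega>
    using nonneg[of \<omega>] assms(3) V_hat_eq_dp_value[of "f \<omega>" i N] by (cases "f \<omega> = 0") (auto simp: g_def)
  ultimately show ?thesis
    by simp
qed

subsection \<open>Growth of the thresholds under endpoint regularity\<close>

text \<open>By \<open>r_sandwich\<close> the difference quotient between \<open>a\<close> and
  \<open>w\<close> lies between \<open>- g a\<close> and \<open>- g w\<close>, so its error is at
  most \<open>\<bar>g w - g a\<bar>\<close>, and \<open>g\<close> is continuous at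
  \<open>a\<close>.\<close>

lemma r_has_derivative:
  assumes "0 \<le> \<eta>" "x0 < a" "a < xF"
  shows "(r \<eta> has_real_derivative - exp (- \<eta> * \<phi> a)) (at a)"
proof -
  define g where "g t = exp (- \<eta> * \<phi> t)" for t
  have "continuous_on {x0<..<xF} \<phi>"
    by (rule continuous_on_subset[OF continuous_on_phi]) auto
  then have "isCont \<phi> a"
    using assms by (simp add: continuous_on_eq_continuous_at)
  then have lim: "(g \<longlongrightarrow> g a) (at a)"
    unfolding g_def isCont_def by (intro tendsto_intros)
  have near: "\<forall>\<^sub>F w in at a. w \<in> {x0<..<xF} \<and> w \<noteq> a"
    using assms by (intro eventually_conj eventually_at_in_open' eventually_neq_at_within) auto
  have "((\<lambda>w. (r \<eta> w - r \<eta> a) / (w - a)) \<longlongrightarrow> - g a) (at a)"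
  proof (rule metric_tendsto_imp_tendsto[OF lim])
    show "\<forall>\<^sub>F w in at a. dist ((r \<eta> w - r \<eta> a) / (w - a)) (- g a) \<le> dist (g w) (g a)"
      using near
    proof eventually_elim
      case (elim w)
      show ?case
      proof (cases "a < w")
        case True
        have "- g a \<le> (r \<eta> w - r \<eta> a) / (w - a)" "(r \<eta> w - r \<eta> a) / (w - a) \<le> - g w"
          using r_sandwich[of \<eta> a w] assms elim True
          by (simp_all add: g_def pos_le_divide_eq pos_divide_le_eq)
        then show ?thesis
          by (simp add: dist_real_def)
      next
        case False
        then have "w < a"
          using elim by simp
        then have "- g w \<le> (r \<eta> w - r \<eta> a) / (w - a)" "(r \<eta> w - r \<eta> a) / (w - a) \<le> - g a"
          using r_sandwich[of \<eta> w a] assms elim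
          by (simp_all add: g_def neg_le_divide_eq neg_divide_le_eq algebra_simps)
        then show ?thesis
          by (simp add: dist_real_def)
      qed
    qed
  qed
  then show ?thesis
    by (simp add: has_field_derivative_iff g_def)
qed

text \<open>The function \<open>psi_bar\<close> differs from \<open>\<psi>\<close> by sign and a
  constant, so the second quotient of the regularity condition is \<open>h' / h\<close>, with limit
  \<open>- c' \<le> 0\<close>. A tolerance of \<open>min e 1\<close> puts it eventually below
  \<open>e\<close> and above \<open>- (c' + 1)\<close>. Multiplied out by \<open>h\<close>, the
  bounds make sense also where \<open>h\<close> vanishes.\<close>

lemma psi_derivative_growth:
  assumes reg: "bounded_endpoint_regular x0 xF \<phi> c c'" and "0 < e"
  obtains Y h h' where "0 < Y"
    "\<And>y. Y \<le> y \<Longrightarrow> (\<psi> has_real_derivative h y) (at y)"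
    "\<And>y. Y \<le> y \<Longrightarrow> (h has_real_derivative h' y) (at y)"
    "\<And>y. Y \<le> y \<Longrightarrow> 0 \<le> h y"
    "\<And>y. Y \<le> y \<Longrightarrow> h' y \<le> e * h y"
    "\<And>y. Y \<le> y \<Longrightarrow> - (c' + 1) * h y \<le> h' y"
proof -
  define h where "h = deriv \<psi>"
  define h' where "h' = deriv h"
  have c': "0 \<le> c'"
    using reg by (simp add: bounded_endpoint_regular_def)
  obtain Y1 where Y1: "\<And>y. Y1 \<le> y \<Longrightarrow> \<psi> differentiable (at y) \<and> h differentiable (at y)"
    using reg by (auto simp: bounded_endpoint_regular_def eventually_at_top_linorder h_def)
  have D1: "(\<psi> has_real_derivative h y) (at y)" if "Y1 \<le> y" for y
    using Y1[OF that] by (simp add: h_def DERIV_deriv_iff_real_differentiable)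
  have D2: "(h has_real_derivative h' y) (at y)" if "Y1 \<le> y" for y
    using Y1[OF that] by (simp add: h'_def DERIV_deriv_iff_real_differentiable)
  have bar1: "deriv (psi_bar x0 xF \<phi>) y = - h y" if "Y1 \<le> y" for y
  proof (rule DERIV_imp_deriv)
    have "psi_bar x0 xF \<phi> = (\<lambda>y. xF - \<psi> y)"
      by (simp add: psi_bar_def fun_eq_iff)
    then show "(psi_bar x0 xF \<phi> has_real_derivative - h y) (at y)"
      using D1[OF that] by (auto intro!: derivative_eq_intros)
  qed
  have bar2: "deriv (deriv (psi_bar x0 xF \<phi>)) y = - h' y" if "Y1 < y" for y
  proof (rule DERIV_imp_deriv)
    have "\<forall>\<^sub>F z in nhds y. deriv (psi_bar x0 xF \<phi>) z = - h z"
      using eventually_nhds_in_open[of "{Y1<..}" y] that bar1 by (auto elim!: eventually_mono)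
    moreover have "((\<lambda>z. - h z) has_real_derivative - h' y) (at y)"
      using D2[of y] that by (auto intro!: derivative_eq_intros)
    ultimately show "(deriv (psi_bar x0 xF \<phi>) has_real_derivative - h' y) (at y)"
      using DERIV_cong_ev[of y y "deriv (psi_bar x0 xF \<phi>)" "\<lambda>z. - h z"] by simp
  qed
  have "((\<lambda>y. deriv (deriv (psi_bar x0 xF \<phi>)) y / deriv (psi_bar x0 xF \<phi>) y) \<longlongrightarrow> - c') at_top"
    using reg by (simp add: bounded_endpoint_regular_def)
  then have "\<forall>\<^sub>F y in at_top. dist (deriv (deriv (psi_bar x0 xF \<phi>)) y / deriv (psi_bar x0 xF \<phi>) y) (- c') < min e 1"
    using \<open>0 < e\<close> by (intro tendstoD) auto
  then obtain Y2 where Y2: "\<And>y. Y2 \<le> y \<Longrightarrow>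
      dist (deriv (deriv (psi_bar x0 xF \<phi>)) y / deriv (psi_bar x0 xF \<phi>) y) (- c') < min e 1"
    by (auto simp: eventually_at_top_linorder)
  \<comment> \<open>The 1 keeps \<open>Y\<close> positive, \<open>Y1 + 2\<close> leaves room to the
    left of each \<open>y \<ge> Y\<close> for the local minimum argument, and from \<open>Y2\<close>
    on the limit has taken hold.\<close>
  define Y where "Y = max (max 1 (Y1 + 2)) Y2"
  have nonneg: "0 \<le> h y" if "max 0 Y1 < y" for y
  proof (rule ccontr)
    assume "\<not> 0 \<le> h y"
    moreover have "Y1 \<le> y"
      using that by simp
    ultimately obtain d where "0 < d" and d: "\<And>k. 0 < k \<Longrightarrow> k < d \<Longrightarrow> \<psi> (y + k) < \<psi> y"
      using DERIV_neg_dec_right[OF D1[of y]] by auto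
    then show False
      using psi_less[of y "y + d / 2"] d[of "d / 2"] that by fastforce
  qed
  have growth: "h' y \<le> e * h y \<and> - (c' + 1) * h y \<le> h' y" if "Y \<le> y" for y
  proof (cases "h y = 0")
    case True
    \<comment> \<open>The quotient in the hypothesis is \<open>0\<close> here; but \<open>y\<close> is a minimum of \<open>h\<close>.\<close>
    have "h' y = 0"
    proof (rule DERIV_local_min[OF D2])
      show "Y1 \<le> y" "0 < min 1 (y - max 0 Y1)"
        using that by (auto simp: Y_def)
      show "\<forall>z. \<bar>y - z\<bar> < min 1 (y - max 0 Y1) \<longrightarrow> h y \<le> h z"
        using True by (auto intro!: nonneg)
    qed
    then show ?thesis
      using True by simp
  next
    case False
    then have pos: "0 < h y"
      using nonneg[of y] that by (simp add: Y_def)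
    have "\<bar>h' y / h y + c'\<bar> < min e 1"
      using Y2[of y] bar1[of y] bar2[of y] that by (simp add: Y_def dist_real_def)
    then have "h' y / h y \<le> e" "- (c' + 1) \<le> h' y / h y"
      using c' by linarith+
    then show ?thesis
      using pos by (simp add: pos_divide_le_eq pos_le_divide_eq)
  qed
  show thesis
  proof (rule that[of Y h h'])
    show "0 < Y"
      by (simp add: Y_def)
  qed (use D1 D2 nonneg growth in \<open>auto simp: Y_def\<close>)
qed

text \<open>In the coordinate \<open>z = \<phi> v\<close> a step adds at most about
  \<open>C * exp (- \<eta> * z)\<close>, so \<open>exp (\<eta> * z)\<close> grows by at most a
  constant per step. This needs an upper bound on \<open>r \<eta> (\<psi> z)\<close> and a lower
  bound on the increase of \<open>\<psi>\<close>, both in terms of \<open>h z\<close>.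
  \<open>A\<close> and \<open>D\<close> serve all \<open>\<eta>\<close> in the range at once, as
  \<open>\<eta>\<close> will vary with the horizon.\<close>

lemma dp_value_le_psi_ln:
  assumes reg: "bounded_endpoint_regular x0 xF \<phi> c c'" and "0 < \<theta>"
  obtains A D where "1 \<le> A" "0 < D"
    "\<And>\<eta> k. \<theta> / 2 \<le> \<eta> \<Longrightarrow> \<eta> \<le> \<theta> \<Longrightarrow> dp_value \<eta> k \<le> \<psi> (ln (A + D * real k) / \<eta>)"
proof -
  obtain Y h h' where "0 < Y"
    and psi': "\<And>y. Y \<le> y \<Longrightarrow> (\<psi> has_real_derivative h y) (at y)"
    and h': "\<And>y. Y \<le> y \<Longrightarrow> (h has_real_derivative h' y) (at y)"
    and h_nonneg: "\<And>y. Y \<le> y \<Longrightarrow> 0 \<le> h y"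
    and h'_le: "\<And>y. Y \<le> y \<Longrightarrow> h' y \<le> \<theta> / 4 * h y"
    and h'_ge: "\<And>y. Y \<le> y \<Longrightarrow> - (c' + 1) * h y \<le> h' y"
    using psi_derivative_growth[OF reg, of "\<theta> / 4"] \<open>0 < \<theta>\<close> by auto
  have c': "0 \<le> c'"
    using reg by (simp add: bounded_endpoint_regular_def)

  have r_psi_le: "r \<eta> (\<psi> z) \<le> 4 / \<theta> * exp (- \<eta> * z) * h z"
    if \<eta>: "\<theta> / 2 \<le> \<eta>" and z: "Y \<le> z" for \<eta> z
  proof -
    \<comment> \<open>\<open>G\<close> is nonincreasing, and far out it is at least
      \<open>- d\<close> for every \<open>d > 0\<close> because
      \<open>r \<eta> (\<psi> w) \<le> xF - \<psi> w\<close>; so \<open>G z \<ge> 0\<close>. The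
      factor \<open>4 / \<theta>\<close> comes from the gap
      \<open>\<eta> - \<theta> / 4 \<ge> \<theta> / 4\<close> between the decay rate of the
      exponential and the growth rate allowed to \<open>h\<close>.\<close>
    define G where "G y = 4 / \<theta> * exp (- \<eta> * y) * h y - r \<eta> (\<psi> y)" for y
    have \<eta>_pos: "0 < \<eta>"
      using \<eta> \<open>0 < \<theta>\<close> by simp
    have decr: "G w \<le> G z" if "z \<le> w" for w
    proof (rule DERIV_nonpos_imp_nonincreasing[OF that])
      fix y assume "z \<le> y" "y \<le> w"
      then have y: "Y \<le> y" "0 < y"
        using z \<open>0 < Y\<close> by auto
      have psi_y: "x0 < \<psi> y" "\<psi> y < xF"
        using psi_less[of 0 y] psi_bounds[of 0] psi_bounds[of y] y by auto
      have "(r \<eta> has_real_derivative - exp (- \<eta> * y)) (at (\<psi> y))"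
        using r_has_derivative[of \<eta> "\<psi> y"] psi_y y \<eta>_pos by (simp add: phi_psi)
      then have "((\<lambda>y. r \<eta> (\<psi> y)) has_real_derivative - exp (- \<eta> * y) * h y) (at y)"
        using DERIV_chain2 psi'[OF y(1)] by blast
      then have "(G has_real_derivative
          4 / \<theta> * exp (- \<eta> * y) * h' y + 4 / \<theta> * (exp (- \<eta> * y) * - \<eta>) * h y
            - (- exp (- \<eta> * y) * h y)) (at y)"
        unfolding G_def using h'[OF y(1)] \<open>0 < \<theta>\<close>
        by (auto intro!: derivative_eq_intros simp: field_simps)
      moreover have "4 / \<theta> * exp (- \<eta> * y) * h' y + 4 / \<theta> * (exp (- \<eta> * y) * - \<eta>) * h y
            - (- exp (- \<eta> * y) * h y) = exp (- \<eta> * y) * (4 / \<theta>) * (h' y - (\<eta> - \<theta> / 4) * h y)"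
        using \<open>0 < \<theta>\<close> by (simp add: field_simps)
      moreover have "h' y - (\<eta> - \<theta> / 4) * h y \<le> 0"
      proof -
        have "\<theta> / 4 * h y \<le> (\<eta> - \<theta> / 4) * h y"
          using \<eta> h_nonneg[OF y(1)] by (intro mult_right_mono) auto
        then show ?thesis
          using h'_le[OF y(1)] by simp
      qed
      then have "exp (- \<eta> * y) * (4 / \<theta>) * (h' y - (\<eta> - \<theta> / 4) * h y) \<le> 0"
        using \<open>0 < \<theta>\<close> by (intro mult_nonneg_nonpos) auto
      ultimately show "\<exists>d. (G has_real_derivative d) (at y) \<and> d \<le> 0"
        by metis
    qed
    have "- d \<le> G z" if "0 < d" for d
    proof -
      define b where "b = max x0 (xF - d)"
      have b: "x0 \<le> b" "b < xF"
        using that x0_less_xF by (auto simp: b_def)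
      define w where "w = max z (\<phi> b)"
      have w: "z \<le> w" "0 \<le> w" "Y \<le> w"
        using z \<open>0 < Y\<close> by (auto simp: w_def)
      have "b \<le> \<psi> w"
        using psi_le[of "\<phi> b" w] b by (simp add: psi_phi phi_nonneg w_def)
      then have "r \<eta> (\<psi> w) \<le> d"
        using r_le[of \<eta> "\<psi> w"] \<eta>_pos psi_bounds[of w] w by (auto simp: b_def)
      moreover have "0 \<le> 4 / \<theta> * exp (- \<eta> * w) * h w"
        using \<open>0 < \<theta>\<close> h_nonneg[OF w(3)] by simp
      ultimately have "- d \<le> G w"
        by (simp add: G_def)
      then show ?thesis
        using decr[OF w(1)] by linarith
    qed
    then have "0 \<le> G z + d" if "0 < d" for d
      using that by (smt (verit))
    then have "0 \<le> G z"
      by (rule field_le_epsilon)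
    then show ?thesis
      by (simp add: G_def)
  qed

  have psi_ge: "\<psi> z + s * (exp (- (c' + 1)) * h z) \<le> \<psi> (z + s)" if "Y \<le> z" "0 < s" "s \<le> 1" for z s
  proof -
    have "\<exists>x>z. x < z + s \<and> \<psi> (z + s) - \<psi> z = (z + s - z) * h x"
      using that by (intro MVT2 psi') auto
    then obtain x where x: "z < x" "x < z + s" "\<psi> (z + s) - \<psi> z = s * h x"
      by auto
    \<comment> \<open>The lower bound on \<open>h'\<close> makes this product nondecreasing, so over
      a distance of at most 1 \<open>h\<close> loses at most the factor
      \<open>exp (- (c' + 1))\<close>.\<close>
    have "exp ((c' + 1) * z) * h z \<le> exp ((c' + 1) * x) * h x"
    proof (rule DERIV_nonneg_imp_nondecreasing[where f = "\<lambda>y. exp ((c' + 1) * y) * h y"])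
      show "z \<le> x"
        using x by simp
      fix y assume "z \<le> y" "y \<le> x"
      then have "Y \<le> y"
        using that by simp
      then have "((\<lambda>y. exp ((c' + 1) * y) * h y) has_real_derivative
          exp ((c' + 1) * y) * (h' y + (c' + 1) * h y)) (at y)"
        using h' by (auto intro!: derivative_eq_intros simp: algebra_simps)
      moreover have "0 \<le> exp ((c' + 1) * y) * (h' y + (c' + 1) * h y)"
        using h'_ge[OF \<open>Y \<le> y\<close>] by (intro mult_nonneg_nonneg) (auto simp: algebra_simps)
      ultimately show "\<exists>d. ((\<lambda>y. exp ((c' + 1) * y) * h y) has_real_derivative d) (at y) \<and> 0 \<le> d"
        by blast
    qed
    then have "exp (- (c' + 1) * x) * (exp ((c' + 1) * z) * h z)
        \<le> exp (- (c' + 1) * x) * (exp ((c' + 1) * x) * h x)"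
      by (intro mult_left_mono) auto
    moreover have "exp (- (c' + 1) * x) * (exp ((c' + 1) * z) * h z) = exp (- (c' + 1) * (x - z)) * h z"
      unfolding mult.assoc[symmetric] mult_exp_exp by (simp add: algebra_simps)
    moreover have "exp (- (c' + 1) * x) * (exp ((c' + 1) * x) * h x) = h x"
      unfolding mult.assoc[symmetric] mult_exp_exp by (simp add: algebra_simps)
    ultimately have "exp (- (c' + 1) * (x - z)) * h z \<le> h x"
      by metis
    moreover have "exp (- (c' + 1)) * h z \<le> exp (- (c' + 1) * (x - z)) * h z"
    proof (rule mult_right_mono)
      have "(c' + 1) * (x - z) \<le> (c' + 1) * 1"
        using x that c' by (intro mult_left_mono) auto
      then show "exp (- (c' + 1)) \<le> exp (- (c' + 1) * (x - z))"
        by (simp add: algebra_simps)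
    qed (use h_nonneg that in auto)
    ultimately have "s * (exp (- (c' + 1)) * h z) \<le> s * h x"
      using that by (intro mult_left_mono) auto
    then show ?thesis
      unfolding x(3)[symmetric] by linarith
  qed

  \<comment> \<open>With \<open>exp (- \<eta> * z) = 1 / E\<close>, the increment
    \<open>C / E\<close> of the coordinate pays exactly for the bound on
    \<open>r \<eta> (\<psi> z)\<close>. \<open>D\<close> is such that raising \<open>E\<close> by
    \<open>D\<close> raises \<open>ln E\<close> by at least \<open>\<eta> * C / E\<close>: once
    \<open>D \<le> E\<close>,
    \<open>D / (E + D) \<ge> D / (2 * E) = \<theta> * C / E\<close>.\<close>
  define C where "C = 4 / \<theta> * exp (c' + 1)"
  have "0 < C"
    using \<open>0 < \<theta>\<close> by (simp add: C_def)
  define D where "D = 2 * \<theta> * C"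
  have "0 < D"
    using \<open>0 < \<theta>\<close> \<open>0 < C\<close> by (simp add: D_def)
  \<comment> \<open>The four terms give, in order, \<open>Y \<le> z\<close>,
    \<open>E + D \<le> 2 * E\<close>, an increment \<open>C / E \<le> 1\<close>, and a nonnegative
    logarithm.\<close>
  define A where "A = max (exp (\<theta> * Y)) (max D (max C 1))"
  have A: "exp (\<theta> * Y) \<le> A" "D \<le> A" "C \<le> A" "1 \<le> A"
    by (auto simp: A_def)
  have bound: "dp_value \<eta> k \<le> \<psi> (ln (A + D * real k) / \<eta>)" if \<eta>: "\<theta> / 2 \<le> \<eta>" "\<eta> \<le> \<theta>" for \<eta> k
  proof (induction k)
    case 0
    show ?case
      using A \<eta> \<open>0 < \<theta>\<close> psi_bounds(1)[of "ln A / \<eta>"] by simp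
  next
    case (Suc k)
    have \<eta>_pos: "0 < \<eta>"
      using \<eta> \<open>0 < \<theta>\<close> by simp
    define E where "E = A + D * real k"
    have "A \<le> E"
      using \<open>0 < D\<close> by (simp add: E_def)
    then have E: "exp (\<theta> * Y) \<le> E" "D \<le> E" "C \<le> E" "1 \<le> E" "0 < E"
      using A by auto
    define z where "z = ln E / \<eta>"
    have "\<eta> * z = ln E"
      using \<eta>_pos by (simp add: z_def)
    then have exp_z: "exp (- \<eta> * z) = 1 / E"
      using E by (simp add: exp_minus divide_inverse)
    have "\<eta> * Y \<le> \<theta> * Y"
      using \<eta> \<open>0 < Y\<close> by simp
    also have "\<theta> * Y \<le> ln E"
      using E by (simp add: ln_ge_iff)
    finally have z: "Y \<le> z"
      using \<eta>_pos by (simp add: z_def pos_le_divide_eq mult.commute)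
    have z_nonneg: "0 \<le> z"
      using z \<open>0 < Y\<close> by simp
    have "dp_value \<eta> (Suc k) \<le> dp_step \<eta> (\<psi> z)"
      unfolding dp_value_Suc using Suc dp_value_bounds[OF \<eta>_pos, of k] \<eta>_pos psi_bounds(2)[OF z_nonneg]
      by (intro dp_step_mono) (auto simp: z_def E_def)
    also have "\<dots> \<le> \<psi> z + C / E * (exp (- (c' + 1)) * h z)"
    proof -
      have "C / E * (exp (- (c' + 1)) * h z) = 4 / \<theta> * exp (- \<eta> * z) * h z"
      proof -
        have "C * exp (- (c' + 1)) = 4 / \<theta>"
          unfolding C_def mult.assoc mult_exp_exp by simp
        then show ?thesis
          unfolding exp_z by (metis mult.assoc mult.commute times_divide_eq_left mult_1)
      qed
      then show ?thesis
        using r_psi_le[OF \<eta>(1) z] by (simp add: dp_step_def)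
    qed
    also have "\<dots> \<le> \<psi> (z + C / E)"
      using E \<open>0 < C\<close> by (intro psi_ge z) auto
    also have "\<dots> \<le> \<psi> (ln (A + D * real (Suc k)) / \<eta>)"
    proof (rule psi_le)
      show "0 \<le> z + C / E"
        using z_nonneg E \<open>0 < C\<close> by simp
      have "\<eta> * C * (E + D) \<le> \<theta> * C * (2 * E)"
        using \<eta> E \<open>0 < C\<close> \<open>0 < D\<close> \<eta>_pos \<open>0 < \<theta>\<close> by (intro mult_mono) auto
      then have "\<eta> * C / E \<le> D / (E + D)"
        using E \<open>0 < D\<close> by (simp add: D_def field_simps)
      also have "D / (E + D) = 1 - E / (E + D)"
        using E \<open>0 < D\<close> by (simp add: field_simps)
      also have "\<dots> \<le> - ln (E / (E + D))"
        using ln_le_minus_one[of "E / (E + D)"] E \<open>0 < D\<close> by simp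
      also have "\<dots> = ln (E + D) - ln E"
        using E \<open>0 < D\<close> by (simp add: ln_div)
      finally have "ln E + \<eta> * C / E \<le> ln (E + D)"
        by simp
      moreover have "\<eta> * (z + C / E) = ln E + \<eta> * C / E"
        using \<eta>_pos by (simp add: z_def field_simps)
      ultimately have "z + C / E \<le> ln (E + D) / \<eta>"
        using \<eta>_pos by (simp add: pos_le_divide_eq mult.commute)
      moreover have "A + D * real (Suc k) = E + D"
        by (simp add: E_def algebra_simps)
      ultimately show "z + C / E \<le> ln (A + D * real (Suc k)) / \<eta>"
        by simp
    qed
    finally show ?case .
  qed
  show thesis
    using that[of A D] A \<open>0 < D\<close> bound by blast
qed

text \<open>The growth bound gives at least \<open>E powr (- \<theta> / \<eta>)\<close> with
  \<open>E \<le> B * k\<close>. With \<open>\<kappa> = 1 / ln n \<le> 1 / 2\<close> the exponent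
  satisfies \<open>\<theta> / \<eta> \<le> 1 + 2 * \<kappa>\<close>, and \<open>k \<le> n\<close>
  gives \<open>\<kappa> * ln E \<le> 1 + ln B\<close>. The wrong rate thus costs only the constant
  factor \<open>exp (- 2 - 2 * ln B)\<close>.\<close>

lemma tail_prob_dp_value_ge:
  assumes reg: "bounded_endpoint_regular x0 xF \<phi> c c'" and "0 < \<theta>"
  obtains a where "0 < a"
    "\<And>n k. 2 \<le> ln (real n) \<Longrightarrow> 1 \<le> k \<Longrightarrow> k \<le> n \<Longrightarrow>
      a / real k \<le> exp (- \<theta> * \<phi> (dp_value (\<theta> * (1 - 1 / ln (real n))) k))"
proof -
  obtain A D where A: "1 \<le> A" and D: "0 < D"
    and bound: "\<And>\<eta> k. \<theta> / 2 \<le> \<eta> \<Longrightarrow> \<eta> \<le> \<theta> \<Longrightarrow> dp_value \<eta> k \<le> \<psi> (ln (A + D * real k) / \<eta>)"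
    using dp_value_le_psi_ln[OF assms] by blast
  define B where "B = A + D"
  have B: "1 \<le> B"
    using A D by (simp add: B_def)
  define a where "a = exp (- 2 - 2 * ln B) / B"
  have "a / real k \<le> exp (- \<theta> * \<phi> (dp_value (\<theta> * (1 - 1 / ln (real n))) k))"
    if n: "2 \<le> ln (real n)" and k: "1 \<le> k" "k \<le> n" for n k
  proof -
    define \<kappa> where "\<kappa> = 1 / ln (real n)"
    define \<eta> where "\<eta> = \<theta> * (1 - \<kappa>)"
    have \<kappa>: "0 < \<kappa>" "\<kappa> \<le> 1 / 2"
      using n by (auto simp: \<kappa>_def field_simps)
    have \<eta>: "\<theta> / 2 \<le> \<eta>" "\<eta> \<le> \<theta>" "0 < \<eta>"
      using \<kappa> \<open>0 < \<theta>\<close> mult_left_mono[of "1 / 2" "1 - \<kappa>" \<theta>] by (auto simp: \<eta>_def)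
    define E where "E = A + D * real k"
    have "D * 1 \<le> D * real k"
      using D k by (intro mult_left_mono) auto
    then have E1: "1 \<le> E"
      using A D unfolding E_def by linarith
    have "A \<le> A * real k"
      using A k by simp
    then have E_le: "E \<le> B * real k"
      by (simp add: E_def B_def algebra_simps)
    also have "\<dots> \<le> B * real n"
      using B k by simp
    finally have "ln E \<le> ln (B * real n)"
      using E1 by simp
    then have ln_E: "ln E \<le> ln B + ln (real n)"
      using B k by (simp add: ln_mult)
    have "\<phi> (dp_value \<eta> k) \<le> ln E / \<eta>"
      using bound[OF \<eta>(1,2), of k] dp_value_bounds[OF \<eta>(3), of k] E1 \<eta>
      by (subst phi_le_iff) (auto simp: E_def)
    then have "\<theta> * \<phi> (dp_value \<eta> k) \<le> \<theta> * (ln E / \<eta>)"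
      using \<open>0 < \<theta>\<close> by (intro mult_left_mono) auto
    also have "\<dots> = (1 / (1 - \<kappa>)) * ln E"
      using \<open>0 < \<theta>\<close> by (simp add: \<eta>_def)
    also have "\<dots> \<le> (1 + 2 * \<kappa>) * ln E"
    proof (rule mult_right_mono)
      have "\<kappa> * \<kappa> \<le> \<kappa> * (1 / 2)"
        using \<kappa> by (intro mult_left_mono) auto
      then show "1 / (1 - \<kappa>) \<le> 1 + 2 * \<kappa>"
        using \<kappa> by (simp add: divide_le_eq algebra_simps)
    qed (use E1 in simp)
    also have "\<dots> = ln E + 2 * (\<kappa> * ln E)"
      by (simp add: algebra_simps)
    also have "\<kappa> * ln E \<le> 1 + ln B"
    proof -
      have "\<kappa> * ln E \<le> \<kappa> * (ln B + ln (real n))"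
        using ln_E \<kappa> by (intro mult_left_mono) auto
      also have "\<dots> = 1 + \<kappa> * ln B"
        using n by (simp add: \<kappa>_def field_simps)
      also have "\<kappa> * ln B \<le> 1 * ln B"
        using \<kappa> B by (intro mult_right_mono) auto
      finally show ?thesis
        by simp
    qed
    finally have "exp (- (ln E + 2 * (1 + ln B))) \<le> exp (- \<theta> * \<phi> (dp_value \<eta> k))"
      by simp
    moreover have "exp (- (ln E + 2 * (1 + ln B))) = exp (- 2 - 2 * ln B) / E"
      using E1 by (simp add: exp_diff exp_minus exp_add divide_inverse algebra_simps)
    moreover have "a / real k \<le> exp (- 2 - 2 * ln B) / E"
    proof -
      have "a / real k = exp (- 2 - 2 * ln B) / (B * real k)"
        by (simp add: a_def)
      also have "\<dots> \<le> exp (- 2 - 2 * ln B) / E"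
        using E_le E1 by (intro divide_left_mono) auto
      finally show ?thesis .
    qed
    ultimately have "a / real k \<le> exp (- \<theta> * \<phi> (dp_value \<eta> k))"
      by linarith
    then show ?thesis
      by (simp only: \<eta>_def \<kappa>_def)
  qed
  moreover have "0 < a"
    using B by (simp add: a_def)
  ultimately show thesis
    using that by blast
qed

subsection \<open>The stopping rule\<close>

text \<open>The summand of \<open>theta_hat\<close>; the value 0 off the support makes it
  Borel.\<close>

definition phi_supp :: "real \<Rightarrow> real" where
  "phi_supp x = (if x \<in> {x0..<xF} then \<phi> x else 0)"

lemma borel_measurable_phi_supp [measurable]: "phi_supp \<in> borel_measurable borel"
  unfolding phi_supp_def[abs_def]
  by (rule borel_measurable_continuous_on_if) (auto intro: continuous_on_phi)

lemma cdp_ol_bounds: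
  assumes "m < n"
  shows "cdp_ol x0 xF \<phi> n m \<delta> x \<in> {1..n}"
proof -
  define S where "S = {t \<in> {1..n - m - 1}. x (m + t) \<ge> V_hat x0 xF \<phi> (theta_U x0 xF \<phi> m \<delta> x) (n - m) (t + 1)}"
  have eq: "cdp_ol x0 xF \<phi> n m \<delta> x = (if S = {} then n else m + Min S)"
    unfolding cdp_ol_def S_def Let_def by (rule refl)
  have "Min S \<in> {1..n - m - 1}" if "S \<noteq> {}"
  proof -
    have "S \<subseteq> {1..n - m - 1}"
      by (auto simp: S_def)
    moreover have "Min S \<in> S"
      using that calculation by (intro Min_in) (auto intro: finite_subset)
    ultimately show ?thesis
      by auto
  qed
  then show ?thesis
    using assms by (cases "S = {}") (auto simp: eq)
qed

text \<open>The thresholds decrease in the rate, so an upper bound on the rate bounds the accepted value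
  from below, and a lower bound on the rate ensures that the rule stops.\<close>

lemma cdp_ol_value_ge:
  assumes "m < n" "1 \<le> K"
    and lo: "0 < lo" "lo \<le> theta_U x0 xF \<phi> m \<delta> x" and hi: "theta_U x0 xF \<phi> m \<delta> x \<le> hi"
    and t: "t \<in> {1..n - m - K}" "dp_value lo (n - m - t) \<le> x (m + t)"
  shows "dp_value hi K \<le> x (cdp_ol x0 xF \<phi> n m \<delta> x)"
proof -
  define \<eta> where "\<eta> = theta_U x0 xF \<phi> m \<delta> x"
  define S where "S = {t \<in> {1..n - m - 1}. x (m + t) \<ge> V_hat x0 xF \<phi> \<eta> (n - m) (t + 1)}"
  have \<eta>: "0 < \<eta>" "lo \<le> \<eta>" "\<eta> \<le> hi"
    using lo hi by (auto simp: \<eta>_def)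
  \<comment> \<open>The index is \<open>Suc (n - m) - (s + 1)\<close>, the number of observations
    left after time \<open>m + s\<close>.\<close>
  have V: "V_hat x0 xF \<phi> \<eta> (n - m) (s + 1) = dp_value \<eta> (n - m - s)" if "s \<in> {1..n - m - 1}" for s
    using \<eta> that by (subst V_hat_eq_dp_value) auto
  have t': "t \<in> {1..n - m - 1}"
    using t(1) \<open>1 \<le> K\<close> by auto
  have "dp_value \<eta> (n - m - t) \<le> dp_value lo (n - m - t)"
    using \<eta> lo by (intro dp_value_antimono_param) auto
  then have "t \<in> S"
    using t t' V[OF t'] by (simp add: S_def)
  moreover have fin: "finite S"
    by (simp add: S_def)
  ultimately have le: "Min S \<le> t" and "S \<noteq> {}"
    by auto
  then have mem: "Min S \<in> S"
    using fin by (intro Min_in)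
  have "cdp_ol x0 xF \<phi> n m \<delta> x = m + Min S"
    using \<open>S \<noteq> {}\<close> unfolding cdp_ol_def S_def \<eta>_def Let_def by (rule if_not_P)
  moreover have "dp_value \<eta> (n - m - Min S) \<le> x (m + Min S)"
    using mem V[of "Min S"] by (auto simp: S_def)
  \<comment> \<open>The rule stops no later than \<open>t \<le> n - m - K\<close>, so at least
    \<open>K\<close> observations are left.\<close>
  moreover have "dp_value hi K \<le> dp_value hi (n - m - Min S)"
    using le t(1) \<eta> by (intro incseqD[OF dp_value_incseq]) auto
  moreover have "\<dots> \<le> dp_value \<eta> (n - m - Min S)"
    using \<eta> by (intro dp_value_antimono_param) auto
  ultimately show ?thesis
    by simp
qed

text \<open>The sum has relative error below \<open>\<kappa>\<close>. For the lower bound,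
  \<open>(1 - \<kappa>) * (1 + \<kappa>) \<le> 1\<close> and the inflation by
  \<open>1 + \<epsilon>\<close> only helps. For the upper bound,
  \<open>1 + \<epsilon> \<le> 3 / 2\<close> and \<open>1 / (1 - \<kappa>) \<le> 4 / 3\<close>
  multiply to 2.\<close>

lemma theta_U_bounds:
  assumes "0 < \<theta>" "1 \<le> m" "0 < \<kappa>" "\<kappa> \<le> 1 / 4" "0 < \<delta>" "\<delta> < 1" "16 * ln (2 / \<delta>) \<le> real m"
    and close: "\<bar>(\<Sum>i=1..m. phi_supp (x i)) - real m / \<theta>\<bar> < real m * \<kappa> / \<theta>"
  shows "\<theta> * (1 - \<kappa>) \<le> theta_U x0 xF \<phi> m \<delta> x" "theta_U x0 xF \<phi> m \<delta> x \<le> 2 * \<theta>"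
proof -
  define S where "S = (\<Sum>i=1..m. phi_supp (x i))"
  define \<epsilon> where "\<epsilon> = sqrt (4 * ln (2 / \<delta>) / real m)"
  have U: "theta_U x0 xF \<phi> m \<delta> x = (1 + \<epsilon>) * (real m / S)"
    by (simp add: theta_U_def theta_hat_def S_def \<epsilon>_def phi_supp_def)
  have "0 < ln (2 / \<delta>)"
    using assms by simp
  then have \<epsilon>: "0 \<le> \<epsilon>" "\<epsilon> \<le> 1 / 2"
  proof -
    have "4 * ln (2 / \<delta>) / real m \<le> (1 / 2)\<^sup>2"
      using assms by (simp add: power2_eq_square divide_le_eq)
    then show "\<epsilon> \<le> 1 / 2"
      unfolding \<epsilon>_def by (intro real_le_lsqrt) auto
  qed (use assms in \<open>simp add: \<epsilon>_def\<close>)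
  have "real m / \<theta> - real m * \<kappa> / \<theta> < S" "S < real m / \<theta> + real m * \<kappa> / \<theta>"
    using close by (auto simp: S_def abs_less_iff)
  then have S: "real m * (1 - \<kappa>) / \<theta> < S" "S < real m * (1 + \<kappa>) / \<theta>"
    by (simp_all add: algebra_simps add_divide_distrib diff_divide_distrib)
  have m: "0 < real m * (1 - \<kappa>) / \<theta>"
    using assms by simp
  then have "0 < S"
    using S by linarith
  have "(1 - \<kappa>) * S \<le> (1 - \<kappa>) * (real m * (1 + \<kappa>) / \<theta>)"
    using S assms by (intro mult_left_mono) auto
  also have "\<dots> = real m / \<theta> * (1 - \<kappa> * \<kappa>)"
    by (simp add: divide_inverse algebra_simps)
  also have "\<dots> \<le> real m / \<theta> * 1"
    using assms by (intro mult_left_mono) auto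
  finally have lower: "\<theta> * (1 - \<kappa>) \<le> real m / S"
    using \<open>0 < S\<close> \<open>0 < \<theta>\<close> by (simp add: field_simps)
  also have "\<dots> \<le> (1 + \<epsilon>) * (real m / S)"
    using \<epsilon> \<open>0 < S\<close> by (simp add: field_simps)
  finally show "\<theta> * (1 - \<kappa>) \<le> theta_U x0 xF \<phi> m \<delta> x"
    by (simp add: U)
  have "real m / S \<le> real m / (real m * (1 - \<kappa>) / \<theta>)"
    using S m \<open>0 < S\<close> by (intro divide_left_mono mult_pos_pos) auto
  also have "\<dots> = \<theta> / (1 - \<kappa>)"
    using assms by simp
  also have "\<dots> \<le> \<theta> / (3 / 4)"
    using assms by (intro divide_left_mono) auto
  finally have "real m / S \<le> 4 / 3 * \<theta>"
    by simp
  then have "(1 + \<epsilon>) * (real m / S) \<le> (3 / 2) * (4 / 3 * \<theta>)"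
    using \<epsilon> \<open>0 < S\<close> by (intro mult_mono) auto
  then show "theta_U x0 xF \<phi> m \<delta> x \<le> 2 * \<theta>"
    by (simp add: U)
qed

end

subsection \<open>Random samples\<close>

locale exp_type_sample = exp_type_family +
  fixes M :: "'a measure" and X :: "nat \<Rightarrow> 'a \<Rightarrow> real" and n :: nat and \<theta> :: real
  assumes iid: "iid_sample M X n (exp_type_cdf x0 xF \<phi> \<theta>)" and \<theta>_pos: "0 < \<theta>"
begin

sublocale prob_space M
  using iid by (simp add: iid_sample_def)

lemma indep: "indep_vars (\<lambda>_. borel) X {1..n}"
  using iid by (simp add: iid_sample_def)

lemma X_measurable: "i \<in> {1..n} \<Longrightarrow> X i \<in> borel_measurable M"
  using indep by (simp add: indep_vars_def)

lemma prob_X_le: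
  assumes i: "i \<in> {1..n}"
  shows "prob {\<omega> \<in> space M. X i \<omega> \<le> x} = F \<theta> x"
proof -
  have "F \<theta> x = cdf (distr M borel (X i)) x"
    using iid i by (simp add: iid_sample_def)
  also have "\<dots> = prob (X i -` {..x} \<inter> space M)"
    using X_measurable[OF i] by (simp add: cdf_def measure_distr)
  also have "X i -` {..x} \<inter> space M = {\<omega> \<in> space M. X i \<omega> \<le> x}"
    by auto
  finally show ?thesis
    by simp
qed

lemma AE_X_bounds:
  assumes i: "i \<in> {1..n}"
  shows "AE \<omega> in M. X i \<omega> \<in> {x0..<xF}"
proof -
  note [measurable] = X_measurable[OF i]
  have "1 \<le> prob {\<omega> \<in> space M. X i \<omega> < xF} + e" if "0 < e" for e
  proof -
    \<comment> \<open>Chosen so that \<open>exp (- \<theta> * y) \<le> e\<close>: mass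
      \<open>1 - e\<close> already lies at or below \<open>\<psi> y < xF\<close>, so
      \<open>xF\<close> carries no atom.\<close>
    define y where "y = max 0 (- ln e / \<theta>)"
    have "- ln e \<le> \<theta> * y"
      using \<theta>_pos mult_left_mono[of "- ln e / \<theta>" y \<theta>] by (simp add: y_def)
    then have "exp (- \<theta> * y) \<le> exp (ln e)"
      by (subst exp_le_cancel_iff) simp
    moreover have "1 - exp (- \<theta> * y) = prob {\<omega> \<in> space M. X i \<omega> \<le> \<psi> y}"
      using psi_bounds[of y] by (simp add: prob_X_le[OF i] exp_type_cdf_def y_def phi_psi not_less)
    moreover have "\<dots> \<le> prob {\<omega> \<in> space M. X i \<omega> < xF}"
      using psi_bounds[of y] by (intro finite_measure_mono) (auto simp: y_def)
    ultimately show ?thesis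
      using that by simp
  qed
  then have "1 \<le> prob {\<omega> \<in> space M. X i \<omega> < xF}"
    by (rule field_le_epsilon)
  then have "AE \<omega> in M. \<omega> \<in> {\<omega> \<in> space M. X i \<omega> < xF}"
    using prob_le_1 by (intro AE_prob_1) (auto intro: antisym)
  moreover have "prob {\<omega> \<in> space M. X i \<omega> \<le> x0} = 0"
    using x0_less_xF by (simp add: prob_X_le[OF i] exp_type_cdf_def)
  then have "{\<omega> \<in> space M. X i \<omega> \<le> x0} \<in> null_sets M"
    by (simp add: null_sets_def emeasure_eq_measure)
  from AE_not_in[OF this] have "AE \<omega> in M. \<omega> \<notin> {\<omega> \<in> space M. X i \<omega> \<le> x0}" .
  ultimately show ?thesis
    by eventually_elim auto
qed

lemma AE_all_X_bounds: "AE \<omega> in M. \<forall>i\<in>{1..n}. X i \<omega> \<in> {x0..<xF}"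
  using AE_X_bounds by (intro AE_finite_allI) auto

text \<open>On the support, \<open>\<phi> x \<le> a\<close> means \<open>x \<le> \<psi> a\<close>.
  This makes the sum in the estimator Erlang distributed, with explicit mean and variance.\<close>

lemma exponential_phi_supp:
  assumes i: "i \<in> {1..n}"
  shows "distributed M lborel (\<lambda>\<omega>. phi_supp (X i \<omega>)) (exponential_density \<theta>)"
  unfolding exponential_distributed_iff[OF \<theta>_pos]
proof (intro conjI allI impI)
  note [measurable] = X_measurable[OF i]
  show "(\<lambda>\<omega>. phi_supp (X i \<omega>)) \<in> borel_measurable M"
    by measurable
  fix a :: real assume a: "0 \<le> a"
  have "prob {\<omega> \<in> space M. phi_supp (X i \<omega>) \<le> a} = prob {\<omega> \<in> space M. X i \<omega> \<le> \<psi> a}"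
  proof (rule finite_measure_eq_AE)
    show "AE \<omega> in M. \<omega> \<in> {\<omega> \<in> space M. phi_supp (X i \<omega>) \<le> a} \<longleftrightarrow> \<omega> \<in> {\<omega> \<in> space M. X i \<omega> \<le> \<psi> a}"
      using AE_X_bounds[OF i] by eventually_elim (use a in \<open>auto simp: phi_supp_def phi_le_iff\<close>)
  qed measurable
  also have "\<dots> = 1 - exp (- a * \<theta>)"
    using psi_bounds[OF a] by (simp add: prob_X_le[OF i] exp_type_cdf_def phi_psi a mult.commute not_less)
  finally show "prob {\<omega> \<in> space M. phi_supp (X i \<omega>) \<le> a} = 1 - exp (- a * \<theta>)" .
qed

lemma prob_sum_deviation_le:
  assumes m: "1 \<le> m" "m \<le> n" and "0 < \<kappa>"
  shows "prob {\<omega> \<in> space M. real m * \<kappa> / \<theta> \<le> \<bar>(\<Sum>i=1..m. phi_supp (X i \<omega>)) - real m / \<theta>\<bar>}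
    \<le> 1 / (real m * \<kappa>\<^sup>2)"
proof -
  \<comment> \<open>\<open>erlang_density k\<close> has shape \<open>k + 1\<close>, so
    \<open>m\<close> summands correspond to \<open>k = m - 1\<close>.\<close>
  obtain k where k: "m = Suc k"
    using m by (cases m) auto
  define S where "S \<omega> = (\<Sum>i=1..m. phi_supp (X i \<omega>))" for \<omega>
  have "indep_vars (\<lambda>_. borel) (\<lambda>i \<omega>. phi_supp (X i \<omega>)) {1..m}"
    using m by (intro indep_vars_subset[OF indep_vars_compose2[OF indep]]) auto
  then have dist: "distributed M lborel S (erlang_density k \<theta>)"
    using exponential_distributed_sum[of "{1..m}" \<theta> "\<lambda>i \<omega>. phi_supp (X i \<omega>)"]
      exponential_phi_supp m \<theta>_pos by (simp add: S_def[abs_def] k)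
  have "expectation S = real m / \<theta>"
    using erlang_ith_moment[OF \<theta>_pos dist, of 1] \<theta>_pos by (simp add: k del: of_nat_Suc)
  moreover have "variance S = real m / \<theta>\<^sup>2"
    using erlang_distributed_variance[OF \<theta>_pos dist] by (simp add: k)
  moreover have "prob {\<omega> \<in> space M. real m * \<kappa> / \<theta> \<le> \<bar>S \<omega> - expectation S\<bar>}
      \<le> variance S / (real m * \<kappa> / \<theta>)\<^sup>2"
  proof (rule Chebyshev_inequality)
    show "S \<in> borel_measurable M"
      using distributed_measurable[OF dist] by simp
    show "integrable M (\<lambda>\<omega>. (S \<omega>)\<^sup>2)"
      by (rule erlang_ith_moment_integrable[OF \<theta>_pos dist])
    show "0 < real m * \<kappa> / \<theta>"
      using m \<theta>_pos \<open>0 < \<kappa>\<close> by simp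
  qed
  moreover have "real m / \<theta>\<^sup>2 / (real m * \<kappa> / \<theta>)\<^sup>2 = 1 / (real m * \<kappa>\<^sup>2)"
    using m \<theta>_pos \<open>0 < \<kappa>\<close> by (simp add: power2_eq_square field_simps)
  ultimately show ?thesis
    by (simp add: S_def)
qed

text \<open>Independence gives a product, and \<open>1 - p \<le> exp (- p)\<close> turns it into the
  exponential of a sum of acceptance probabilities.\<close>

lemma prob_all_less_le:
  assumes J: "J \<noteq> {}" "J \<subseteq> {1..n}" and u: "\<And>i. i \<in> J \<Longrightarrow> x0 \<le> u i \<and> u i < xF"
  shows "prob {\<omega> \<in> space M. \<forall>i\<in>J. X i \<omega> < u i} \<le> exp (- (\<Sum>i\<in>J. exp (- \<theta> * \<phi> (u i))))"
proof -
  have fin: "finite J"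
    using J finite_subset by blast
  have "{\<omega> \<in> space M. \<forall>i\<in>J. X i \<omega> < u i} = (\<Inter>i\<in>J. X i -` {..<u i} \<inter> space M)"
    using J by auto
  then have "prob {\<omega> \<in> space M. \<forall>i\<in>J. X i \<omega> < u i} = (\<Prod>i\<in>J. prob (X i -` {..<u i} \<inter> space M))"
    using indep_varsD[OF indep J(1) fin J(2), of "\<lambda>i. {..<u i}"] by simp
  also have "\<dots> \<le> (\<Prod>i\<in>J. exp (- exp (- \<theta> * \<phi> (u i))))"
  proof (intro prod_mono conjI)
    fix i assume i: "i \<in> J"
    then have i': "i \<in> {1..n}"
      using J by auto
    have "prob (X i -` {..<u i} \<inter> space M) \<le> prob {\<omega> \<in> space M. X i \<omega> \<le> u i}"
      using X_measurable[OF i'] by (intro finite_measure_mono) auto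
    also have "\<dots> = 1 + - exp (- \<theta> * \<phi> (u i))"
      using u[OF i] by (simp add: prob_X_le[OF i'] exp_type_cdf_def not_less)
    also have "\<dots> \<le> exp (- exp (- \<theta> * \<phi> (u i)))"
      by (rule exp_ge_add_one_self)
    finally show "prob (X i -` {..<u i} \<inter> space M) \<le> exp (- exp (- \<theta> * \<phi> (u i)))" .
  qed simp
  also have "\<dots> = exp (- (\<Sum>i\<in>J. exp (- \<theta> * \<phi> (u i))))"
    using fin by (simp add: exp_sum[symmetric] sum_negf)
  finally show ?thesis .
qed

section \<open>Measurability and expected reward of the rule\<close>

lemma measurable_cdp_ol:
  assumes "m < n" "0 < \<delta>" "\<delta> < 1"
  shows "(\<lambda>\<omega>. cdp_ol x0 xF \<phi> n m \<delta> (\<lambda>i. X i \<omega>)) \<in> measurable M (count_space UNIV)"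
proof -
  define \<eta> where "\<eta> \<omega> = theta_U x0 xF \<phi> m \<delta> (\<lambda>i. X i \<omega>)" for \<omega>
  define S where "S \<omega> = {t \<in> {1..n - m - 1}. X (m + t) \<omega> \<ge> V_hat x0 xF \<phi> (\<eta> \<omega>) (n - m) (t + 1)}" for \<omega>
  have \<eta>_eq: "\<eta> \<omega> = (1 + sqrt (4 * ln (2 / \<delta>) / real m)) * (real m / (\<Sum>i=1..m. phi_supp (X i \<omega>)))" for \<omega>
    by (simp add: \<eta>_def theta_U_def theta_hat_def phi_supp_def)
  have "(\<lambda>\<omega>. \<Sum>i=1..m. phi_supp (X i \<omega>)) \<in> borel_measurable M"
    using assms X_measurable by (intro borel_measurable_sum measurable_compose[OF _ borel_measurable_phi_supp]) auto
  then have \<eta>: "\<eta> \<in> borel_measurable M"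
    unfolding \<eta>_eq[abs_def] by measurable
  have \<eta>_nonneg: "0 \<le> \<eta> \<omega>" for \<omega>
    unfolding \<eta>_eq using assms phi_nonneg
    by (intro mult_nonneg_nonneg divide_nonneg_nonneg sum_nonneg add_nonneg_nonneg)
      (auto simp: phi_supp_def)
  \<comment> \<open>The stopping time is a function of the random set \<open>S\<close>, which has
    finitely many values; so it suffices that each event \<open>S \<omega> = A\<close> is
    measurable.\<close>
  have S: "S \<in> measurable M (count_space (Pow {1..n - m - 1}))"
    unfolding measurable_count_space_eq2[OF finite_Pow_iff[THEN iffD2, OF finite_atLeastAtMost]]
  proof (intro conjI ballI)
    show "S \<in> space M \<rightarrow> Pow {1..n - m - 1}"
      by (auto simp: S_def)
    fix A assume A: "A \<in> Pow {1..n - m - 1}"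
    define C where "C t \<omega> \<longleftrightarrow> V_hat x0 xF \<phi> (\<eta> \<omega>) (n - m) (t + 1) \<le> X (m + t) \<omega>" for t \<omega>
    have C: "{\<omega> \<in> space M. C t \<omega>} \<in> sets M" if "t \<in> {1..n - m - 1}" for t
      unfolding C_def using that assms
      by (intro borel_measurable_le borel_measurable_V_hat[OF \<eta> \<eta>_nonneg] X_measurable) auto
    have "S \<omega> = {t \<in> {1..n - m - 1}. C t \<omega>}" for \<omega>
      unfolding S_def C_def by (rule refl)
    then have "S \<omega> = A \<longleftrightarrow> (\<forall>t\<in>{1..n - m - 1}. C t \<omega> \<longleftrightarrow> t \<in> A)" for \<omega>
      using A by blast
    then have "S -` {A} \<inter> space M = {\<omega> \<in> space M. \<forall>t\<in>{1..n - m - 1}. C t \<omega> \<longleftrightarrow> t \<in> A}"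
      by blast
    also have "\<dots> \<in> sets M"
    proof (intro sets.sets_Collect_finite_All finite_atLeastAtMost)
      show "{\<omega> \<in> space M. C t \<omega> \<longleftrightarrow> t \<in> A} \<in> sets M" if "t \<in> {1..n - m - 1}" for t
        using C[OF that] by (cases "t \<in> A") (auto intro: sets.sets_Collect_neg)
    qed
    finally show "S -` {A} \<inter> space M \<in> sets M" .
  qed
  have "(\<lambda>\<omega>. (\<lambda>A. if A = {} then n else m + Min A) (S \<omega>)) \<in> measurable M (count_space UNIV)"
    by (rule measurable_compose[OF S]) simp
  then show ?thesis
    unfolding cdp_ol_def S_def \<eta>_def Let_def .
qed

lemma borel_measurable_X_stopped:
  assumes \<tau>: "\<tau> \<in> measurable M (count_space UNIV)" and bounds: "\<And>\<omega>. \<tau> \<omega> \<in> {1..n}"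
  shows "(\<lambda>\<omega>. X (\<tau> \<omega>) \<omega>) \<in> borel_measurable M"
proof -
  note [measurable] = \<tau>
  have "(\<lambda>\<omega>. \<Sum>i=1..n. if \<tau> \<omega> = i then X i \<omega> else 0) \<in> borel_measurable M"
    using X_measurable by (intro borel_measurable_sum measurable_If) auto
  moreover have "(\<Sum>i=1..n. if \<tau> \<omega> = i then X i \<omega> else 0) = X (\<tau> \<omega>) \<omega>" for \<omega>
    using bounds[of \<omega>] by simp
  ultimately show ?thesis
    by simp
qed

text \<open>The reward is at least \<open>v\<close> on \<open>G\<close> and almost surely
  nonnegative elsewhere, while the expected maximum is at most \<open>xF\<close>.\<close>

lemma competitive_ratio_ge:
  assumes \<tau>: "\<tau> \<in> measurable M (count_space UNIV)" and bounds: "\<And>\<omega>. \<tau> \<omega> \<in> {1..n}"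
    and G: "G \<in> events" "\<And>\<omega>. \<omega> \<in> G \<Longrightarrow> v \<le> X (\<tau> \<omega>) \<omega>" and v: "0 \<le> v"
  shows "v / xF * prob G \<le> competitive_ratio M X n \<tau>"
proof -
  define R where "R \<omega> = X (\<tau> \<omega>) \<omega>" for \<omega>
  define Z where "Z \<omega> = (MAX t\<in>{1..n}. X t \<omega>)" for \<omega>
  have n: "{1..n} \<noteq> {}"
    using bounds by (metis empty_iff)
  have xF: "0 < xF"
    using x0_nonneg x0_less_xF by simp
  have mR: "R \<in> borel_measurable M"
    unfolding R_def[abs_def] using \<tau> bounds by (rule borel_measurable_X_stopped)
  have mZ: "Z \<in> borel_measurable M"
    unfolding Z_def[abs_def] using X_measurable n by (intro borel_measurable_Max) auto
  have AE_R: "AE \<omega> in M. 0 \<le> R \<omega> \<and> R \<omega> \<le> xF"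
    using AE_all_X_bounds
  proof eventually_elim
    case (elim \<omega>)
    then show ?case
      using bspec[OF elim bounds[of \<omega>]] x0_nonneg by (simp add: R_def)
  qed
  have AE_Z: "AE \<omega> in M. 0 \<le> Z \<omega> \<and> Z \<omega> \<le> xF"
    using AE_all_X_bounds
  proof eventually_elim
    case (elim \<omega>)
    have "Z \<omega> \<in> (\<lambda>t. X t \<omega>) ` {1..n}"
      unfolding Z_def using n by (intro Max_in) auto
    then obtain i where i: "i \<in> {1..n}" "Z \<omega> = X i \<omega>"
      by blast
    then show ?case
      using bspec[OF elim i(1)] x0_nonneg by simp
  qed
  have intR: "integrable M R"
    using AE_R mR by (intro integrable_const_bound[where B = xF]) auto
  have intZ: "integrable M Z"
    using AE_Z mZ by (intro integrable_const_bound[where B = xF]) auto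
  have "v * prob G = expectation (\<lambda>\<omega>. v * indicator G \<omega>)"
    using G by simp
  also have "\<dots> \<le> expectation R"
  proof (rule integral_mono_AE)
    show "integrable M (\<lambda>\<omega>. v * indicator G \<omega>)"
      using G(1) by (simp add: emeasure_eq_measure)
    show "AE \<omega> in M. v * indicator G \<omega> \<le> R \<omega>"
      using AE_R by eventually_elim (use G(2) in \<open>auto simp: indicator_def R_def\<close>)
  qed (rule intR)
  finally have v_le: "v * prob G \<le> expectation R" .
  have R_nonneg: "0 \<le> expectation R"
    using AE_R by (intro integral_nonneg_AE) auto
  have "R \<omega> \<le> Z \<omega>" for \<omega>
    unfolding R_def Z_def using bounds[of \<omega>] by (intro Max_ge) auto
  then have R_le_Z: "expectation R \<le> expectation Z"
    using intR intZ by (intro integral_mono) auto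
  have "expectation Z \<le> expectation (\<lambda>_. xF)"
    using intZ AE_Z by (intro integral_mono_AE) auto
  then have Z_le: "expectation Z \<le> xF"
    by (simp add: prob_space)
  have "v / xF * prob G \<le> expectation R / xF"
    using v_le xF by (simp add: divide_right_mono)
  \<comment> \<open>If the expected maximum is 0, the quotient is 0 by \<open>x / 0 = 0\<close>; but
    then the expected reward is 0 too.\<close>
  also have "\<dots> \<le> expectation R / expectation Z"
  proof (cases "expectation Z = 0")
    case True
    then have "expectation R = 0"
      using R_nonneg R_le_Z by simp
    then show ?thesis
      by simp
  next
    case False
    then show ?thesis
      using R_nonneg R_le_Z Z_le xF by (intro divide_left_mono) auto
  qed
  finally show ?thesis
    unfolding competitive_ratio_def expected_max_def R_def Z_def .
qed

text \<open>Two bad events are split off: a poor estimate (\<open>B1\<close>, by Chebyshev) and no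
  observation reaching the thresholds of the rate \<open>\<theta> * (1 - \<kappa>)\<close>
  (\<open>B2\<close>, by independence). Outside both, \<open>cdp_ol_value_ge\<close> bounds the
  accepted value.\<close>

lemma competitive_ratio_cdp_ol_ge:
  assumes m: "1 \<le> m" "m < n" and K: "1 \<le> K" "K < n - m"
    and \<kappa>: "0 < \<kappa>" "\<kappa> \<le> 1 / 4" and \<delta>: "0 < \<delta>" "\<delta> < 1" "16 * ln (2 / \<delta>) \<le> real m"
  shows "dp_value (2 * \<theta>) K / xF
      * (1 - 1 / (real m * \<kappa>\<^sup>2) - exp (- (\<Sum>k=K..<n - m. exp (- \<theta> * \<phi> (dp_value (\<theta> * (1 - \<kappa>)) k)))))
    \<le> competitive_ratio M X n (\<lambda>\<omega>. cdp_ol x0 xF \<phi> n m \<delta> (\<lambda>i. X i \<omega>))"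
proof -
  define lo where "lo = \<theta> * (1 - \<kappa>)"
  have lo: "0 < lo"
    using \<kappa> \<theta>_pos by (simp add: lo_def)
  \<comment> \<open>The times after exploration with at least \<open>K\<close> observations to
    come.\<close>
  define J where "J = {m + 1..n - K}"
  have J: "J \<noteq> {}" "J \<subseteq> {1..n}" "finite J"
    using K m by (auto simp: J_def)
  note X_J [measurable] = X_measurable[OF subsetD[OF J(2)]]
  have S [measurable]: "(\<lambda>\<omega>. \<Sum>i=1..m. phi_supp (X i \<omega>)) \<in> borel_measurable M"
    using m X_measurable by (intro borel_measurable_sum measurable_compose[OF _ borel_measurable_phi_supp]) auto
  define B1 where "B1 = {\<omega> \<in> space M. real m * \<kappa> / \<theta> \<le> \<bar>(\<Sum>i=1..m. phi_supp (X i \<omega>)) - real m / \<theta>\<bar>}"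
  \<comment> \<open>The actual thresholds depend on the first \<open>m\<close> observations; those
    for \<open>lo\<close> are deterministic, so independence applies.\<close>
  define B2 where "B2 = {\<omega> \<in> space M. \<forall>i\<in>J. X i \<omega> < dp_value lo (n - i)}"
  have events: "B1 \<in> events" "B2 \<in> events"
    unfolding B1_def B2_def using J(3) by measurable
  have "prob (B1 \<union> B2) \<le> prob B1 + prob B2"
    using events by (intro measure_Un_le)
  moreover have "prob B1 \<le> 1 / (real m * \<kappa>\<^sup>2)"
    unfolding B1_def using m \<kappa> by (intro prob_sum_deviation_le) auto
  moreover have "prob B2 \<le> exp (- (\<Sum>k=K..<n - m. exp (- \<theta> * \<phi> (dp_value lo k))))"
  proof -
    have "(\<Sum>i\<in>J. exp (- \<theta> * \<phi> (dp_value lo (n - i)))) = (\<Sum>k=K..<n - m. exp (- \<theta> * \<phi> (dp_value lo k)))"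
      using m K by (intro sum.reindex_bij_witness[of _ "\<lambda>k. n - k" "\<lambda>i. n - i"]) (auto simp: J_def)
    then show ?thesis
      unfolding B2_def using prob_all_less_le[OF J(1,2), of "\<lambda>i. dp_value lo (n - i)"] dp_value_bounds[OF lo] by simp
  qed
  moreover have "prob (space M - (B1 \<union> B2)) = 1 - prob (B1 \<union> B2)"
    using events by (intro prob_compl) auto
  ultimately have good: "1 - 1 / (real m * \<kappa>\<^sup>2) - exp (- (\<Sum>k=K..<n - m. exp (- \<theta> * \<phi> (dp_value lo k))))
      \<le> prob (space M - (B1 \<union> B2))"
    by linarith
  have U_nonneg: "0 \<le> dp_value (2 * \<theta>) K"
    using dp_value_bounds(1)[of "2 * \<theta>" K] \<theta>_pos x0_nonneg by simp
  have "dp_value (2 * \<theta>) K / xF * prob (space M - (B1 \<union> B2))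
      \<le> competitive_ratio M X n (\<lambda>\<omega>. cdp_ol x0 xF \<phi> n m \<delta> (\<lambda>i. X i \<omega>))"
  proof (rule competitive_ratio_ge)
    show "(\<lambda>\<omega>. cdp_ol x0 xF \<phi> n m \<delta> (\<lambda>i. X i \<omega>)) \<in> measurable M (count_space UNIV)"
      using m \<delta> by (intro measurable_cdp_ol)
    show "cdp_ol x0 xF \<phi> n m \<delta> (\<lambda>i. X i \<omega>) \<in> {1..n}" for \<omega>
      using m(2) by (rule cdp_ol_bounds)
    show "space M - (B1 \<union> B2) \<in> events"
      using events by auto
    show "0 \<le> dp_value (2 * \<theta>) K"
      by (rule U_nonneg)
    fix \<omega> assume \<omega>: "\<omega> \<in> space M - (B1 \<union> B2)"
    then have close: "\<bar>(\<Sum>i=1..m. phi_supp (X i \<omega>)) - real m / \<theta>\<bar> < real m * \<kappa> / \<theta>"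
      by (auto simp: B1_def not_le)
    obtain i where i: "i \<in> J" "dp_value lo (n - i) \<le> X i \<omega>"
      using \<omega> by (auto simp: B2_def not_less)
    have U: "lo \<le> theta_U x0 xF \<phi> m \<delta> (\<lambda>i. X i \<omega>)" "theta_U x0 xF \<phi> m \<delta> (\<lambda>i. X i \<omega>) \<le> 2 * \<theta>"
      unfolding lo_def using theta_U_bounds[OF \<theta>_pos m(1) \<kappa> \<delta> close] by auto
    show "dp_value (2 * \<theta>) K \<le> X (cdp_ol x0 xF \<phi> n m \<delta> (\<lambda>i. X i \<omega>)) \<omega>"
    proof -
      have "i - m \<in> {1..n - m - K}" "n - m - (i - m) = n - i" "m + (i - m) = i"
        using i(1) K m by (auto simp: J_def)
      then show ?thesis
        using cdp_ol_value_ge[OF m(2) K(1) lo U, of "i - m"] i(2) by simp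
    qed
  qed
  moreover have "0 \<le> dp_value (2 * \<theta>) K / xF"
    using U_nonneg x0_nonneg x0_less_xF by simp
  ultimately show ?thesis
    using mult_left_mono[OF good] unfolding lo_def by (meson order_trans)
qed

end

subsection \<open>The competitive ratio in the limit\<close>

text \<open>The left side telescopes into terms \<open>ln (1 + 1 / k) \<le> 1 / k\<close>.\<close>

lemma sum_inverse_ge_ln:
  assumes "1 \<le> K" "K \<le> N"
  shows "ln (real N) - ln (real K) \<le> (\<Sum>k=K..<N. 1 / real k)"
  using assms(2)
proof (induction N rule: dec_induct)
  case (step k)
  have k: "0 < real k"
    using step assms by simp
  have "ln (real (Suc k)) - ln (real k) = ln (1 + 1 / real k)"
  proof -
    have "1 + 1 / real k = real (Suc k) / real k"
      using k by (simp add: field_simps)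
    then show ?thesis
      using k by (simp add: ln_div)
  qed
  also have "\<dots> \<le> 1 / real k"
    using k by (intro ln_add_one_self_le_self) simp
  finally show ?case
    using step by simp
qed simp

theorem theorem10:
  fixes x0 xF c c' \<theta> \<delta> :: real and \<phi> :: "real \<Rightarrow> real"
    and m :: "nat \<Rightarrow> nat"
    and M :: "nat \<Rightarrow> 'a measure" and X :: "nat \<Rightarrow> nat \<Rightarrow> 'a \<Rightarrow> real"
  assumes "exp_type x0 xF \<phi>"
    and "bounded_endpoint_regular x0 xF \<phi> c c'"
    and "\<theta> > 0"
    and "0 < \<delta>" and "\<delta> < 1"
    and "(\<lambda>n. real (m n)) \<in> o(\<lambda>n. real n)"
    and "(\<lambda>n. real (m n)) \<in> \<omega>(\<lambda>n. ln (1 / \<delta>) * (ln (real n))\<^sup>2)"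
    and "\<And>n. n \<ge> 1 \<Longrightarrow> iid_sample (M n) (X n) n (exp_type_cdf x0 xF \<phi> \<theta>)"
  shows "liminf (\<lambda>n. ereal (competitive_ratio (M n) (X n) n
            (\<lambda>\<omega>. cdp_ol x0 xF \<phi> n (m n) \<delta> (\<lambda>i. X n i \<omega>)))) \<ge> ereal (1 - \<delta>)"
proof -
  interpret exp_type_family x0 xF \<phi>
    by standard (rule assms(1))
  have xF: "0 < xF"
    using x0_nonneg x0_less_xF by simp
  obtain a where a: "0 < a" and tail: "\<And>n k. 2 \<le> ln (real n) \<Longrightarrow> 1 \<le> k \<Longrightarrow> k \<le> n \<Longrightarrow>
      a / real k \<le> exp (- \<theta> * \<phi> (dp_value (\<theta> * (1 - 1 / ln (real n))) k))"
    using tail_prob_dp_value_ge[OF assms(2,3)] by blast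
  \<comment> \<open>Error budget: a factor \<open>1 - \<delta> / 2\<close> for the accepted value
    and \<open>\<delta> / 4\<close> for each bad event; then
    \<open>(1 - \<delta> / 2) * (1 - \<delta> / 2) \<ge> 1 - \<delta>\<close>.\<close>
  have "xF * (1 - \<delta> / 2) < xF"
    using xF assms(4) by simp
  then obtain K0 where "xF * (1 - \<delta> / 2) \<le> dp_value (2 * \<theta>) K0"
    using dp_value_eventually_ge[of "2 * \<theta>"] assms(3) by auto
  moreover define K where "K = Suc K0"
  ultimately have "xF * (1 - \<delta> / 2) \<le> dp_value (2 * \<theta>) K"
    using incseqD[OF dp_value_incseq[of "2 * \<theta>"], of K0 K] assms(3) by simp
  then have UK: "1 - \<delta> / 2 \<le> dp_value (2 * \<theta>) K / xF"
    using xF by (simp add: pos_le_divide_eq mult.commute)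
  have K: "1 \<le> K"
    by (simp add: K_def)
  \<comment> \<open>With \<open>L = ln n \<ge> R\<close>, the terms give in order:
    \<open>\<kappa> = 1 / L \<le> 1 / 4\<close>; \<open>16 * ln (2 / \<delta>) \<le> m\<close>,
    since \<open>L \<le> m\<close>; \<open>K < N\<close>; and a sum of acceptance probabilities of
    at least \<open>ln (4 / \<delta>)\<close>.\<close>
  define R where "R = Max {4, 16 * ln (2 / \<delta>), ln 2 + ln (real K) + 1, ln 2 + ln (real K) + ln (4 / \<delta>) / a}"
  have ln_large: "\<forall>\<^sub>F n in sequentially. R \<le> ln (real n)"
    by (rule eventually_compose_filterlim[OF eventually_ge_at_top
          filterlim_compose[OF ln_at_top filterlim_real_sequentially]])
  have m_small: "\<forall>\<^sub>F n in sequentially. norm (real (m n)) \<le> 1 / 2 * norm (real n)"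
    using assms(6) by (intro landau_o.smallD) auto
  \<comment> \<open>The constant cancels \<open>ln (1 / \<delta>)\<close> and leaves
    \<open>m \<ge> 4 / \<delta> * L\<^sup>2\<close>, which makes the Chebyshev bound
    \<open>L\<^sup>2 / m\<close> at most \<open>\<delta> / 4\<close>.\<close>
  have m_large: "\<forall>\<^sub>F n in sequentially.
      4 / \<delta> / ln (1 / \<delta>) * norm (ln (1 / \<delta>) * (ln (real n))\<^sup>2) \<le> norm (real (m n))"
    using assms(4,5,7) by (intro landau_omega.smallD) auto
  have "\<forall>\<^sub>F n in sequentially. 1 - \<delta> \<le> competitive_ratio (M n) (X n) n
            (\<lambda>\<omega>. cdp_ol x0 xF \<phi> n (m n) \<delta> (\<lambda>i. X n i \<omega>))"
    using ln_large m_small m_large eventually_ge_at_top[of 1]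
  proof eventually_elim
    case (elim n)
    define L where "L = ln (real n)"
    have R: "4 \<le> L" "16 * ln (2 / \<delta>) \<le> L" "ln 2 + ln (real K) + 1 \<le> L"
        "ln 2 + ln (real K) + ln (4 / \<delta>) / a \<le> L"
      using elim(1) by (auto simp: R_def L_def)
    define l where "l = ln (1 / \<delta>)"
    have "0 < l"
      using assms by (simp add: l_def)
    then have mL: "4 / \<delta> * L\<^sup>2 \<le> real (m n)"
      using elim(3) unfolding l_def[symmetric] L_def[symmetric] by (simp add: abs_mult)
    have "L * 1 \<le> L * L"
      using R by (intro mult_left_mono) auto
    also have "1 * (L * L) \<le> 4 / \<delta> * (L * L)"
      using assms(4,5) by (intro mult_right_mono) (auto simp: field_simps)
    finally have L_le: "L \<le> real (m n)"
      using mL by (simp add: power2_eq_square)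
    have m_half: "real (m n) \<le> real n / 2"
      using elim(2) by simp
    have m: "1 \<le> m n" "m n < n"
      using L_le R m_half elim(4) by auto
    define N where "N = n - m n"
    have N: "real n / 2 \<le> real N"
      using m m_half by (simp add: N_def of_nat_diff)
    have "ln (real n / 2) \<le> ln (real N)"
      using N elim(4) by (subst ln_le_cancel_iff) auto
    then have ln_N: "L - ln 2 \<le> ln (real N)"
      using elim(4) by (simp add: L_def ln_div)
    then have "ln (real K) < ln (real N)"
      using R by simp
    then have KN: "K < N"
      using K N elim(4) by (subst (asm) ln_less_cancel_iff) auto
    interpret S: exp_type_sample x0 xF \<phi> "M n" "X n" n \<theta>
      by standard (use assms elim in auto)
    define s where "s = (\<Sum>k=K..<N. exp (- \<theta> * \<phi> (dp_value (\<theta> * (1 - 1 / L)) k)))"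
    have "1 / (real (m n) * (1 / L)\<^sup>2) \<le> \<delta> / 4"
      using mL R m assms(4) by (simp add: field_simps)
    moreover have "exp (- s) \<le> \<delta> / 4"
    proof -
      have "a * (L - ln 2 - ln (real K)) \<le> a * (\<Sum>k=K..<N. 1 / real k)"
        using sum_inverse_ge_ln[OF K, of N] KN ln_N a by (intro mult_left_mono) auto
      also have "\<dots> = (\<Sum>k=K..<N. a / real k)"
        by (simp add: sum_distrib_left)
      also have "\<dots> \<le> s"
        unfolding s_def L_def using R K by (intro sum_mono tail) (auto simp: N_def L_def)
      finally have "a * (L - ln 2 - ln (real K)) \<le> s" .
      moreover have "ln (4 / \<delta>) / a \<le> L - ln 2 - ln (real K)"
        using R by simp
      then have "ln (4 / \<delta>) \<le> a * (L - ln 2 - ln (real K))"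
        using a by (simp add: pos_divide_le_eq mult.commute)
      ultimately have "exp (- s) \<le> exp (- ln (4 / \<delta>))"
        by simp
      then show ?thesis
        using assms(4) by (simp add: exp_minus)
    qed
    ultimately have good: "1 - \<delta> / 2 \<le> 1 - 1 / (real (m n) * (1 / L)\<^sup>2) - exp (- s)"
      by simp
    have "1 - \<delta> \<le> (1 - \<delta> / 2) * (1 - \<delta> / 2)"
      by (simp add: algebra_simps)
    also have "\<dots> \<le> dp_value (2 * \<theta>) K / xF * (1 - 1 / (real (m n) * (1 / L)\<^sup>2) - exp (- s))"
      using UK good assms(4,5) by (intro mult_mono) auto
    also have "\<dots> \<le> competitive_ratio (M n) (X n) n (\<lambda>\<omega>. cdp_ol x0 xF \<phi> n (m n) \<delta> (\<lambda>i. X n i \<omega>))"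
      unfolding s_def N_def using m K KN R L_le assms(4,5)
      by (intro S.competitive_ratio_cdp_ol_ge) (auto simp: N_def divide_le_eq)
    finally show ?case .
  qed
  then show ?thesis
    by (intro Liminf_bounded) (auto elim!: eventually_mono)
qed

end
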